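(* Let $\Omega\subset\mathbb{R}^2$ be a simply connected polygonal domain with a triangulation $\mathcal{T}_h$ of $\overline{\Omega}$ into uniform squares of side $h$, satisfying the standing mesh assumption stated in the context. Then the set $$\mathcal{B}=\{\mathbf{\Psi}_h^{Q}\ :\ Q \text{ is an interior square in } \mathcal{T}_h\}$$ is a basis for the space $$V_h=\{\mathbf{v}_h\in[\mathcal{NC}^h_0(\Omega)]^2\ :\ \mathrm{div}_h\,\mathbf{v}_h=0\}.$$
   Context: Mesh: $\mathcal{T}_h$ is a (finite) triangulation of $\overline{\Omega}$ into uniform squares of width and height $h$ (sides parallel to the coordinate axes). A vertex or edge of $\mathcal{T}_h$ is a boundary vertex or edge if it belongs to $\partial\Omega$; otherwise it is an interior vertex or edge. A square of $\mathcal{T}_h$ is an interior square if all its 4 vertices are interior vertices; otherwise it is a boundary square. Standing mesh assumption: no square has 4 boundary vertices; no interior edge meets 2 boundary vertices; if a square has only two boundary vertices, they are the two endpoints of one edge. $P_1$-nonconforming spaces: $\mathcal{NC}^h(\Omega)$ is the set of $v_h\in L^2(\Omega)$ such that $v_h|_Q\in\mathrm{span}\{1,x,y\}$ for every square $Q\in\mathcal{T}_h$ and $v_h$ is continuous at every midpoint of the edges of $\mathcal{T}_h$. $\mathcal{NC}^h_0(\Omega)$ is the subspace of those $v_h\in\mathcal{NC}^h(\Omega)$ with $v_h(m)=0$ for all midpoints $m$ of boundary edges. A function in $\mathcal{NC}^h(\Omega)$ is determined by its values at the midpoints of edges, and prescribed values $c_m$ at midpoints are attained by some function in $\mathcal{NC}^h(\Omega)$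 if and only if on every square with clockwise numbered edge midpoints $m_1,\dots,m_4$ one has $c_{m_1}+c_{m_3}=c_{m_2}+c_{m_4}$. Discrete divergence: $(\mathrm{div}_h\mathbf{v})|_Q=\mathrm{div}(\mathbf{v}|_Q)$ for all $Q\in\mathcal{T}_h$. For an interior vertex $\mathbf{V}$ and $(a,b)\in\mathbb{R}^2$, $\psi^{\mathbf{V}}[a,b]\in[\mathcal{NC}^h_0(\Omega)]^2$ is the function whose value at the midpoint $m$ of an edge of $\mathcal{T}_h$ is $(a,b)$ if the edge meets $\mathbf{V}$ (i.e. has $\mathbf{V}$ as an endpoint), and $(0,0)$ otherwise. For a square $Q$, denote by $\mathbf{V}^{rt}(Q),\mathbf{V}^{lt}(Q),\mathbf{V}^{lb}(Q),\mathbf{V}^{rb}(Q)$ its right-top, left-top, left-bottom, right-bottom vertices. For an interior square $Q$, $$\mathbf{\Psi}_h^Q=\psi^{\mathbf{V}^{rt}(Q)}[\tfrac12,-\tfrac12]+\psi^{\mathbf{V}^{lt}(Q)}[\tfrac12,\tfrac12]+\psi^{\mathbf{V}^{lb}(Q)}[-\tfrac12,\tfrac12]+\psi^{\mathbf{V}^{rb}(Q)}[-\tfrac12,-\tfrac12].$$ *)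

theory Defs
  imports "HOL-Analysis.Analysis" "HOL-Library.Function_Algebras"
begin

text \<open>
  Spaces of functions are real vector spaces with pointwise operations, so that the library's
  \<^const>\<open>independent\<close> and \<^const>\<open>span\<close> apply to sets of functions.
\<close>

instantiation "fun" :: (type, real_vector) real_vector
begin

definition scaleR_fun :: "real \<Rightarrow> ('a \<Rightarrow> 'b) \<Rightarrow> 'a \<Rightarrow> 'b" where
  "scaleR_fun c f = (\<lambda>x. c *\<^sub>R f x)"

instance
  by standard (auto simp: scaleR_fun_def plus_fun_def fun_eq_iff algebra_simps)

end

type_synonym point = "real \<times> real"

text \<open>
  A domain whose boundary is made of finitely many segments and which lies on one side of its
  boundary (no cracks, no punctures): this is the equation \<open>interior (closure \<Omega>) = \<Omega>\<close>.
  The boundary is not required to be a simple curve.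
\<close>

definition polygonal_domain :: "point set \<Rightarrow> bool" where
  "polygonal_domain \<Omega> \<longleftrightarrow>
     open \<Omega> \<and> connected \<Omega> \<and> bounded \<Omega> \<and> \<Omega> \<noteq> {} \<and>
     interior (closure \<Omega>) = \<Omega> \<and>
     (\<exists>S :: (point \<times> point) set. finite S \<and> frontier \<Omega> = (\<Union>(a, b)\<in>S. closed_segment a b))"

text \<open>
  For a fixed side length \<open>h\<close>, a square is encoded by its left-bottom vertex \<open>p\<close>, and a mesh by the
  set \<open>T\<close> of the left-bottom vertices of its squares.  An edge is encoded by the pair of its
  endpoints, the left (for horizontal edges) or lower (for vertical ones) endpoint first, so that
  an edge shared by two squares is one and the same pair.
\<close>

definition V_lb :: "real \<Rightarrow> point \<Rightarrow> point" where "V_lb h p = p"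
definition V_rb :: "real \<Rightarrow> point \<Rightarrow> point" where "V_rb h p = p + (h, 0)"
definition V_lt :: "real \<Rightarrow> point \<Rightarrow> point" where "V_lt h p = p + (0, h)"
definition V_rt :: "real \<Rightarrow> point \<Rightarrow> point" where "V_rt h p = p + (h, h)"

definition square :: "real \<Rightarrow> point \<Rightarrow> point set" where
  "square h p = cbox (V_lb h p) (V_rt h p)"

definition open_square :: "real \<Rightarrow> point \<Rightarrow> point set" where
  "open_square h p = box (V_lb h p) (V_rt h p)"

definition square_vertices :: "real \<Rightarrow> point \<Rightarrow> point set" where
  "square_vertices h p = {V_rt h p, V_lt h p, V_lb h p, V_rb h p}"

definition square_edges :: "real \<Rightarrow> point \<Rightarrow> (point \<times> point) set" where
  "square_edges h p =
     {(V_lb h p, V_rb h p), (V_lt h p, V_rt h p), (V_lb h p, V_lt h p), (V_rb h p, V_rt h p)}"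

definition mesh_edges :: "real \<Rightarrow> point set \<Rightarrow> (point \<times> point) set" where
  "mesh_edges h T = (\<Union>p\<in>T. square_edges h p)"

definition square_triangulation :: "point set \<Rightarrow> real \<Rightarrow> point set \<Rightarrow> bool" where
  "square_triangulation \<Omega> h T \<longleftrightarrow>
     h > 0 \<and> finite T \<and> closure \<Omega> = (\<Union>p\<in>T. square h p) \<and>
     (\<forall>p\<in>T. \<forall>q\<in>T. p \<noteq> q \<longrightarrow>
        square h p \<inter> square h q = {} \<or>
        (\<exists>a \<in> square_vertices h p \<inter> square_vertices h q. square h p \<inter> square h q = {a}) \<or>
        (\<exists>(a, b) \<in> square_edges h p \<inter> square_edges h q.
           square h p \<inter> square h q = closed_segment a b))"

definition boundary_vertex :: "point set \<Rightarrow> point \<Rightarrow> bool" where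
  "boundary_vertex \<Omega> a \<longleftrightarrow> a \<in> frontier \<Omega>"

definition boundary_edge :: "point set \<Rightarrow> point \<times> point \<Rightarrow> bool" where
  "boundary_edge \<Omega> e \<longleftrightarrow> closed_segment (fst e) (snd e) \<subseteq> frontier \<Omega>"

definition interior_square :: "point set \<Rightarrow> real \<Rightarrow> point \<Rightarrow> bool" where
  "interior_square \<Omega> h p \<longleftrightarrow> (\<forall>a\<in>square_vertices h p. \<not> boundary_vertex \<Omega> a)"

definition mesh_assumption :: "point set \<Rightarrow> real \<Rightarrow> point set \<Rightarrow> bool" where
  "mesh_assumption \<Omega> h T \<longleftrightarrow>
     (\<forall>p\<in>T. \<exists>a\<in>square_vertices h p. \<not> boundary_vertex \<Omega> a) \<and>
     (\<forall>(a, b)\<in>mesh_edges h T. \<not> boundary_edge \<Omega> (a, b) \<longrightarrow>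
        \<not> (boundary_vertex \<Omega> a \<and> boundary_vertex \<Omega> b)) \<and>
     (\<forall>p\<in>T. card {a \<in> square_vertices h p. boundary_vertex \<Omega> a} = 2 \<longrightarrow>
        (\<exists>(a, b)\<in>square_edges h p. {c \<in> square_vertices h p. boundary_vertex \<Omega> c} = {a, b}))"

definition mesh_cells :: "real \<Rightarrow> point set \<Rightarrow> point set" where
  "mesh_cells h T = (\<Union>p\<in>T. open_square h p)"

definition L2 :: "point set \<Rightarrow> (point \<Rightarrow> real) \<Rightarrow> bool" where
  "L2 \<Omega> v \<longleftrightarrow> set_borel_measurable lebesgue \<Omega> v \<and> set_integrable lebesgue \<Omega> (\<lambda>z. (v z)\<^sup>2)"

text \<open>
  Elements of the nonconforming spaces are classes of functions modulo null sets and have no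
  values on the edges.  Each class has exactly one representative that is affine at every point of
  the open squares and vanishes outside their union \<^const>\<open>mesh_cells\<close>; the
  spaces consist of these representatives.  Continuity at a midpoint and the value there refer to
  the limit along \<^const>\<open>mesh_cells\<close>, that is, to the limits from all adjacent squares at once.
\<close>

definition has_midpoint_value ::
  "real \<Rightarrow> point set \<Rightarrow> (point \<Rightarrow> 'a::topological_space) \<Rightarrow> point \<times> point \<Rightarrow> 'a \<Rightarrow> bool" where
  "has_midpoint_value h T v e c \<longleftrightarrow>
     (v \<longlongrightarrow> c) (at (midpoint (fst e) (snd e)) within mesh_cells h T)"

definition NC :: "point set \<Rightarrow> real \<Rightarrow> point set \<Rightarrow> (point \<Rightarrow> real) set" where
  "NC \<Omega> h T = {v. L2 \<Omega> v \<and>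
     (\<forall>z. z \<notin> mesh_cells h T \<longrightarrow> v z = 0) \<and>
     (\<forall>p\<in>T. \<exists>\<alpha> \<beta> \<gamma>. \<forall>(x, y)\<in>open_square h p. v (x, y) = \<alpha> + \<beta> * x + \<gamma> * y) \<and>
     (\<forall>e\<in>mesh_edges h T. \<exists>c. has_midpoint_value h T v e c)}"

definition NC0 :: "point set \<Rightarrow> real \<Rightarrow> point set \<Rightarrow> (point \<Rightarrow> real) set" where
  "NC0 \<Omega> h T = {v \<in> NC \<Omega> h T.
     \<forall>e\<in>mesh_edges h T. boundary_edge \<Omega> e \<longrightarrow> has_midpoint_value h T v e 0}"

definition NC0_vec :: "point set \<Rightarrow> real \<Rightarrow> point set \<Rightarrow> (point \<Rightarrow> real \<times> real) set" where
  "NC0_vec \<Omega> h T = {v. (\<lambda>z. fst (v z)) \<in> NC0 \<Omega> h T \<and> (\<lambda>z. snd (v z)) \<in> NC0 \<Omega> h T}"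

definition divergence :: "(point \<Rightarrow> real \<times> real) \<Rightarrow> point \<Rightarrow> real" where
  "divergence v z =
     fst (frechet_derivative v (at z) (1, 0)) + snd (frechet_derivative v (at z) (0, 1))"

definition div_h :: "real \<Rightarrow> point set \<Rightarrow> (point \<Rightarrow> real \<times> real) \<Rightarrow> point \<Rightarrow> real" where
  "div_h h T v z = (if z \<in> mesh_cells h T then divergence v z else 0)"

definition psi ::
  "point set \<Rightarrow> real \<Rightarrow> point set \<Rightarrow> point \<Rightarrow> real \<times> real \<Rightarrow> point \<Rightarrow> real \<times> real" where
  "psi \<Omega> h T V ab = (THE v. v \<in> NC0_vec \<Omega> h T \<and>
     (\<forall>(a, b)\<in>mesh_edges h T.
        has_midpoint_value h T v (a, b) (if V = a \<or> V = b then ab else (0, 0))))"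

definition Psi :: "point set \<Rightarrow> real \<Rightarrow> point set \<Rightarrow> point \<Rightarrow> point \<Rightarrow> real \<times> real" where
  "Psi \<Omega> h T p =
     psi \<Omega> h T (V_rt h p) (1/2, -1/2) + psi \<Omega> h T (V_lt h p) (1/2, 1/2) +
     psi \<Omega> h T (V_lb h p) (-1/2, 1/2) + psi \<Omega> h T (V_rb h p) (-1/2, -1/2)"

definition V_space :: "point set \<Rightarrow> real \<Rightarrow> point set \<Rightarrow> (point \<Rightarrow> real \<times> real) set" where
  "V_space \<Omega> h T = {v \<in> NC0_vec \<Omega> h T. div_h h T v = 0}"

end

theory Submission
  imports Defs "HOL-Complex_Analysis.Riemann_Mapping"
begin

text \<open>
  All squares belong to one lattice, so the mesh is a finite set of cells of \<open>\<int>\<^sup>2\<close>, and the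
  functions of the theorem are governed by functions on lattice vertices and on lattice cells.
  Two facts carry the proof.

  The first is algebraic: a closed discrete one-form on the whole lattice that vanishes far to the
  left has a potential that vanishes far to the left (\<open>lattice_potential\<close>).  The data given on the
  mesh extend by zero to the whole lattice, and closedness survives the extension because the data
  vanish on the boundary.

  The second is topological: the complement of a bounded simply connected domain is connected, and
  it is the union of the lattice cells that do not belong to the mesh.  Hence a property of vertices
  that passes between the vertices of each such cell holds at every vertex outside the domain as
  soon as it holds at one of them (\<open>propagate_over_complement\<close>).  A potential that vanishes far away
  therefore vanishes on the entire complement, boundary vertices included.

  These facts are used twice.  If \<open>v\<close> is a scalar function with zero boundary values, its four midpoint
  values on a cell satisfy \<open>c\<^sub>1 + c\<^sub>3 = c\<^sub>2 + c\<^sub>4\<close>.  This is the closedness that yields vertex values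
  \<open>f\<close>, zero at all vertices outside the domain, such that \<open>v\<close> has the value \<open>f a + f b\<close> at the
  midpoint of the edge from \<open>a\<close> to \<open>b\<close> (\<open>NC0_imp_interp\<close>).

  For a vector field with vertex values \<open>(a, b)\<close>, put \<open>s = a + b\<close> and \<open>d = a - b\<close>.  The divergence on a
  cell is, up to the factor \<open>h\<close>, the sum \<open>s(rt) - s(lb) + d(rb) - d(lt)\<close> over its vertices.  Its vanishing
  is the closedness of the one-form on cells whose increment across a vertex is, up to sign, \<open>d\<close> or \<open>s\<close> along
  the two diagonal directions.  The potential \<open>g\<close> is a discrete stream function; it vanishes on
  all cells that touch the complement, that is, on all cells that are not interior squares
  (\<open>divergence_free_imp_curl\<close>).  The field with vertex values \<open>curl g\<close> is exactly the combination of
  the functions \<open>\<Psi>\<^sup>Q\<close> with the coefficients \<open>g Q\<close> (\<open>sum_Psi\<close>), which gives spanning.  A stream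
  function with zero curl is constant along diagonals, and it vanishes far away, so it is zero: this
  gives independence (\<open>stream_function_unique\<close>).
\<close>

section \<open>Potentials on the integer lattice\<close>

text \<open>
  The increments are prescribed along the two directions \<open>(1, u2)\<close> and \<open>(w1, w2)\<close>, and each step multiplies
  the old value by \<open>\<sigma>\<close>.  Two instances matter: \<open>\<sigma> = -1\<close> with the coordinate directions, where \<open>f\<close>
  consists of vertex values and \<open>p\<close>, \<open>q\<close> are the sums over the edges, and \<open>\<sigma> = 1\<close> with the two
  diagonals, where \<open>f\<close> is a stream function on cells.  The first direction always advances the first
  coordinate, so it determines \<open>f\<close> by recursion from the region where everything is zero; the
  second relation then follows from compatibility by induction on the first coordinate.
\<close>
lemma lattice_potential:
  fixes p q :: "int \<Rightarrow> int \<Rightarrow> real"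
  assumes w1: "w1 = 0 \<or> w1 = 1"
    and compat: "\<And>i j. p (i + w1) (j + w2) + \<sigma> * q i j = q (i + 1) (j + u2) + \<sigma> * p i j"
    and p0: "\<And>i j. i < m \<Longrightarrow> p i j = 0" and q0: "\<And>i j. i < m \<Longrightarrow> q i j = 0"
  obtains f where "\<And>i j. f (i + 1) (j + u2) = p i j + \<sigma> * f i j"
    and "\<And>i j. f (i + w1) (j + w2) = q i j + \<sigma> * f i j"
    and "\<And>i j. i \<le> m \<Longrightarrow> f i j = 0"
proof -
  \<comment> \<open>\<open>G n j\<close> is the value in column \<open>m + n\<close>; column \<open>m\<close> is the last one where \<open>f\<close> is forced to vanish.\<close>
  define G where "G = rec_nat (\<lambda>j. 0) (\<lambda>n g j. p (m + int n) (j - u2) + \<sigma> * g (j - u2))"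
  define f where "f i j = G (nat (i - m)) j" for i j
  have left: "f i j = 0" if "i \<le> m" for i j
    using that by (simp add: f_def G_def)
  have stepu: "f (i + 1) (j + u2) = p i j + \<sigma> * f i j" for i j
  proof (cases "i < m")
    case True
    then show ?thesis using left[of "i+1"] left[of i] p0 by simp
  next
    case False
    then have "nat (i + 1 - m) = Suc (nat (i - m))" "m + int (nat (i - m)) = i" by auto
    then show ?thesis by (simp add: f_def G_def)
  qed
  \<comment> \<open>Starting at \<open>m - 1\<close>, where both sides are zero for either value of \<open>w1\<close>.\<close>
  have stepw: "\<forall>j. f (i + w1) (j + w2) = q i j + \<sigma> * f i j" if "m - 1 \<le> i" for i
    using that
  proof (induction i rule: int_ge_induct)
    case base
    show ?case using w1 left q0 by auto
  next
    case (step i)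
    show ?case
    proof
      fix j
      have "f (i + 1 + w1) (j + w2) = p (i + w1) (j - u2 + w2) + \<sigma> * f (i + w1) (j - u2 + w2)"
        using stepu[of "i + w1" "j - u2 + w2"] by (simp add: algebra_simps)
      also have "\<dots> = p (i + w1) (j - u2 + w2) + \<sigma> * q i (j - u2) + \<sigma> * (\<sigma> * f i (j - u2))"
        using step.IH[rule_format, of "j - u2"] by (simp add: algebra_simps)
      also have "\<dots> = q (i + 1) j + \<sigma> * (p i (j - u2) + \<sigma> * f i (j - u2))"
        using compat[of i "j - u2"] by (simp add: algebra_simps)
      also have "\<dots> = q (i + 1) j + \<sigma> * f (i + 1) j"
        using stepu[of i "j - u2"] by simp
      finally show "f (i + 1 + w1) (j + w2) = q (i + 1) j + \<sigma> * f (i + 1) j" .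
    qed
  qed
  have stepw': "f (i + w1) (j + w2) = q i j + \<sigma> * f i j" for i j
  proof (cases "i < m")
    case True
    then show ?thesis using w1 left q0 by auto
  next
    case False
    then show ?thesis using stepw[of i] by auto
  qed
  show ?thesis using that stepu stepw' left by blast
qed

section \<open>Square lattices in the plane\<close>

text \<open>
  In the complex plane this is a consequence of the Riemann mapping theorem; it is carried over to pairs
  of reals by the evident linear homeomorphism.
\<close>
lemma simply_connected_imp_connected_complement:
  fixes S :: "(real \<times> real) set"
  assumes "open S" "bounded S" "simply_connected S"
  shows "connected (- S)"
proof -
  define cpx where "cpx = (\<lambda>z::real\<times>real. Complex (fst z) (snd z))"
  define prd where "prd = (\<lambda>w. (Re w, Im w))"
  have lin: "bounded_linear cpx" "bounded_linear prd"
    unfolding cpx_def prd_def Complex_eq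
    by (auto intro!: bounded_linear_intros bounded_linear_Re bounded_linear_Im bounded_linear_Pair
       bounded_linear_add bounded_linear_compose[OF bounded_linear_of_real]
       bounded_linear_compose[OF bounded_linear_mult_right] bounded_linear_fst bounded_linear_snd)
  have inv: "prd (cpx z) = z" "cpx (prd w) = w" for z w
    by (auto simp: cpx_def prd_def)
  have cont: "continuous_on A cpx" "continuous_on B prd" for A B
    using lin by (auto intro: linear_continuous_on)
  have img: "cpx ` A = prd -` A" for A
    by (intro set_eqI) (metis imageE imageI inv(1) inv(2) vimage_eq)
  have imgc: "prd ` (- (cpx ` S)) = - S"
    unfolding img vimage_Compl[symmetric] using surj_image_vimage_eq[OF surjI[of prd cpx]] inv by blast
  have "open (cpx ` S)"
    unfolding img using cont(2)[of UNIV] assms(1) by (simp add: continuous_on_open_vimage)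
  moreover have "bounded (cpx ` S)"
    using lin(1) assms(2) bounded_linear_image by blast
  moreover have "S homeomorphic cpx ` S"
    unfolding homeomorphic_def using cont inv
    by (intro exI[of _ cpx] exI[of _ prd] homeomorphismI) auto
  then have "simply_connected (cpx ` S)"
    using assms(3) homeomorphic_simply_connected by blast
  ultimately have "connected (- (cpx ` S))"
    using simply_connected_iff_simple by blast
  then show ?thesis
    using connected_continuous_image[OF cont(2)] imgc by metis
qed

lemma mem_cbox_pair:
  fixes a b z :: point
  shows "z \<in> cbox a b \<longleftrightarrow> fst a \<le> fst z \<and> fst z \<le> fst b \<and> snd a \<le> snd z \<and> snd z \<le> snd b"
  by (cases a; cases b; cases z) (auto simp: cbox_Pair_iff)

lemma mem_box_pair:
  fixes a b z :: point
  shows "z \<in> box a b \<longleftrightarrow> fst a < fst z \<and> fst z < fst b \<and> snd a < snd z \<and> snd z < snd b"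
  by (cases a; cases b; cases z) (auto simp: box_def Basis_prod_def)

text \<open>
  What the proof needs to know about the domain and its mesh.  All squares are translates of one
  another by multiples of \<open>h\<close>, so that vertices and cells can be indexed by pairs of integers: the
  cell with index \<open>(i, j)\<close> is the square whose left-bottom vertex is \<open>pt i j\<close>.
\<close>
locale square_mesh =
  fixes \<Omega> :: "point set" and h :: real and T :: "point set" and org :: point
  assumes h_pos: "h > 0" and finite_T: "finite T"
    and open_domain: "open \<Omega>" and bounded_domain: "bounded \<Omega>"
    and regular_domain: "interior (closure \<Omega>) = \<Omega>"
    and closure_domain: "closure \<Omega> = (\<Union>p\<in>T. square h p)"
    and connected_complement: "connected (- \<Omega>)"
    and T_lattice: "\<And>p. p \<in> T \<Longrightarrow> \<exists>i j. p = org + (h * of_int i, h * of_int j)"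
begin

definition pt :: "int \<Rightarrow> int \<Rightarrow> point" where
  "pt i j = org + (h * of_int i, h * of_int j)"

text \<open>Coordinates in which the vertices are the points with integer coordinates.\<close>
definition X :: "point \<Rightarrow> real" where "X z = (fst z - fst org) / h"
definition Y :: "point \<Rightarrow> real" where "Y z = (snd z - snd org) / h"

lemma XY_pt [simp]: "X (pt i j) = of_int i" "Y (pt i j) = of_int j"
  using h_pos by (auto simp: X_def Y_def pt_def)

lemma pt_eq_iff [simp]: "pt i j = pt k l \<longleftrightarrow> i = k \<and> j = l"
  using XY_pt by (metis of_int_eq_iff)

lemma T_cases:
  assumes "p \<in> T"
  obtains i j where "p = pt i j"
  using T_lattice[OF assms] unfolding pt_def by blast

lemma V_pt [simp]:
  "V_lb h (pt i j) = pt i j" "V_rb h (pt i j) = pt (i + 1) j"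
  "V_lt h (pt i j) = pt i (j + 1)" "V_rt h (pt i j) = pt (i + 1) (j + 1)"
  by (auto simp: V_lb_def V_rb_def V_lt_def V_rt_def pt_def algebra_simps)

lemma mem_square_iff:
  "z \<in> square h (pt i j) \<longleftrightarrow>
     of_int i \<le> X z \<and> X z \<le> of_int i + 1 \<and> of_int j \<le> Y z \<and> Y z \<le> of_int j + 1"
  using h_pos unfolding square_def V_pt
  by (auto simp: mem_cbox_pair pt_def X_def Y_def field_simps)

lemma mem_open_square_iff:
  "z \<in> open_square h (pt i j) \<longleftrightarrow>
     of_int i < X z \<and> X z < of_int i + 1 \<and> of_int j < Y z \<and> Y z < of_int j + 1"
  using h_pos unfolding open_square_def V_pt
  by (auto simp: mem_box_pair pt_def X_def Y_def field_simps)

lemma continuous_XY [continuous_intros]: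
  "continuous_on A X" "continuous_on A Y"
  unfolding X_def Y_def by (auto intro!: continuous_intros simp: h_pos less_imp_neq[symmetric])

text \<open>
  Local finiteness of the lattice, in the form in which it is used: the neighbourhood is the product of
  the largest open intervals around the coordinates of \<open>a\<close> that contain no integer except possibly
  these coordinates themselves.
\<close>
lemma neighbourhood_meets_same_squares:
  obtains U where "open U" "a \<in> U"
    "\<And>z i j. z \<in> U \<Longrightarrow> z \<in> square h (pt i j) \<Longrightarrow> a \<in> square h (pt i j)"
proof
  let ?lo = "\<lambda>x::real. of_int (\<lceil>x\<rceil> - 1) :: real" and ?hi = "\<lambda>x::real. of_int (\<lfloor>x\<rfloor> + 1) :: real"
  let ?U = "{z. ?lo (X a) < X z \<and> X z < ?hi (X a) \<and> ?lo (Y a) < Y z \<and> Y z < ?hi (Y a)}"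
  show "open ?U"
    by (intro open_Collect_conj open_Collect_less continuous_intros)
  show "a \<in> ?U"
    by (auto; linarith)
  show "a \<in> square h (pt i j)" if "z \<in> ?U" "z \<in> square h (pt i j)" for z i j
  proof -
    have *: "of_int k \<le> x \<and> x \<le> of_int k + 1"
      if "?lo x < y" "y < ?hi x" "of_int k \<le> y" "y \<le> of_int k + 1" for k and x y :: real
    proof -
      have "of_int k < ?hi x" "?lo x < of_int (k + 1)" using that by auto
      then have "k \<le> \<lfloor>x\<rfloor>" "\<lceil>x\<rceil> \<le> k + 1" by linarith+
      then show ?thesis by linarith
    qed
    show ?thesis using that * by (auto simp: mem_square_iff)
  qed
qed

lemma square_exists: "\<exists>i j. z \<in> square h (pt i j)"
  by (rule exI[of _ "\<lfloor>X z\<rfloor>"], rule exI[of _ "\<lfloor>Y z\<rfloor>"]) (auto simp: mem_square_iff; linarith)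

lemma open_square_nonempty: "open_square h (pt i j) \<noteq> {}"
proof -
  have "org + (h * (of_int i + 1 / 2), h * (of_int j + 1 / 2)) \<in> open_square h (pt i j)"
    using h_pos by (auto simp: mem_open_square_iff X_def Y_def)
  then show ?thesis by blast
qed

lemma closure_open_square: "closure (open_square h (pt i j)) = square h (pt i j)"
  using open_square_nonempty[of i j] closure_box unfolding open_square_def square_def by blast

lemma open_open_square [simp]: "open (open_square h p)"
  by (simp add: open_square_def open_box)

lemma open_square_in_square:
  assumes "z \<in> open_square h (pt i j)" "z \<in> square h (pt k l)"
  shows "k = i \<and> l = j"
proof -
  have *: "k = i" if "of_int i < x" "x < of_int i + 1" "of_int k \<le> x" "x \<le> of_int k + 1"
    for i k and x :: real
    using that by linarith
  show ?thesis using assms * unfolding mem_square_iff mem_open_square_iff by blast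
qed

text \<open>
  The interior of a cell meets no other cell, so it misses the closure of the domain when the cell
  is not in the mesh.  Since the domain is open, it also misses the closure of that interior.
\<close>
lemma non_mesh_square_disjoint:
  assumes "pt i j \<notin> T"
  shows "square h (pt i j) \<inter> \<Omega> = {}"
proof -
  have "open_square h (pt i j) \<inter> \<Omega> = {}"
  proof (rule ccontr)
    assume "open_square h (pt i j) \<inter> \<Omega> \<noteq> {}"
    then obtain z where z: "z \<in> open_square h (pt i j)" "z \<in> closure \<Omega>"
      using closure_subset by blast
    then obtain p where "p \<in> T" "z \<in> square h p" using closure_domain by blast
    moreover obtain k l where "p = pt k l" using T_cases \<open>p \<in> T\<close> by blast
    ultimately show False using z open_square_in_square assms by blast
  qed
  then show ?thesis
    using open_domain closure_open_square open_Int_closure_eq_empty Int_commute by metis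
qed

text \<open>
  If all cells at \<open>z\<close> were in the mesh, they would fill a neighbourhood of \<open>z\<close>, and \<open>z\<close> would be an
  interior point of the closure of the domain.  This excludes cracks and punctures, which could otherwise
  lie in the complement without being covered by cells.
\<close>
lemma complement_covered:
  assumes "z \<notin> \<Omega>"
  obtains i j where "pt i j \<notin> T" "z \<in> square h (pt i j)"
proof (rule ccontr)
  assume "\<not> thesis"
  with that have *: "pt i j \<in> T" if "z \<in> square h (pt i j)" for i j using that by metis
  obtain U where U: "open U" "z \<in> U"
    "\<And>y i j. y \<in> U \<Longrightarrow> y \<in> square h (pt i j) \<Longrightarrow> z \<in> square h (pt i j)"
    using neighbourhood_meets_same_squares[of z] by metis
  have "U \<subseteq> closure \<Omega>"
  proof
    fix y assume "y \<in> U"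
    obtain i j where "y \<in> square h (pt i j)" using square_exists by blast
    then show "y \<in> closure \<Omega>"
      using U(3) * \<open>y \<in> U\<close> closure_domain by blast
  qed
  then have "z \<in> interior (closure \<Omega>)" using U interior_maximal by blast
  then show False using assms regular_domain by simp
qed

lemma pt_mem_square_iff: "pt k l \<in> square h (pt i j) \<longleftrightarrow> (k = i \<or> k = i + 1) \<and> (l = j \<or> l = j + 1)"
proof -
  have *: "of_int i \<le> (of_int k :: real) \<and> (of_int k :: real) \<le> of_int i + 1 \<longleftrightarrow> k = i \<or> k = i + 1" for i k
    by linarith
  show ?thesis using *[of i k] *[of j l] by (auto simp: mem_square_iff)
qed

lemma vertex_in_domain_iff:
  "pt i j \<in> \<Omega> \<longleftrightarrow> pt i j \<in> T \<and> pt (i - 1) j \<in> T \<and> pt i (j - 1) \<in> T \<and> pt (i - 1) (j - 1) \<in> T"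
proof
  assume "pt i j \<in> \<Omega>"
  then have "pt k l \<in> T" if "pt i j \<in> square h (pt k l)" for k l
    using that non_mesh_square_disjoint by blast
  then show "pt i j \<in> T \<and> pt (i - 1) j \<in> T \<and> pt i (j - 1) \<in> T \<and> pt (i - 1) (j - 1) \<in> T"
    by (simp add: pt_mem_square_iff)
next
  assume *: "pt i j \<in> T \<and> pt (i - 1) j \<in> T \<and> pt i (j - 1) \<in> T \<and> pt (i - 1) (j - 1) \<in> T"
  show "pt i j \<in> \<Omega>"
  proof (rule ccontr)
    assume "pt i j \<notin> \<Omega>"
    then obtain k l where "pt k l \<notin> T" "pt i j \<in> square h (pt k l)"
      using complement_covered by blast
    then have "(k = i \<or> k = i - 1) \<and> (l = j \<or> l = j - 1)" by (auto simp: pt_mem_square_iff)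
    then show False using * \<open>pt k l \<notin> T\<close> by auto
  qed
qed

text \<open>
  The discrete form of the connectedness of the complement.  Call a point good if \<open>P\<close> holds at all
  vertices of the non-mesh cells that contain it.  Goodness is locally constant on the complement, because
  all cells that contain points close to \<open>z\<close> contain \<open>z\<close>, and cells with a common point have
  a common vertex.
\<close>
lemma propagate_over_complement:
  fixes P :: "int \<Rightarrow> int \<Rightarrow> bool"
  assumes step: "\<And>i j k l k' l'. \<lbrakk>pt i j \<notin> T; pt k l \<in> square h (pt i j); pt k' l' \<in> square h (pt i j); P k l\<rbrakk>
      \<Longrightarrow> P k' l'"
    and start: "pt a b \<notin> \<Omega>" "P a b" and target: "pt c d \<notin> \<Omega>"
  shows "P c d"
proof -
  define R where "R z \<longleftrightarrow> (\<forall>i j. pt i j \<notin> T \<longrightarrow> z \<in> square h (pt i j) \<longrightarrow>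
      (\<forall>k l. pt k l \<in> square h (pt i j) \<longrightarrow> P k l))" for z
  have "R (pt c d)"
  proof (rule connected_induction_simple[OF connected_complement, of "pt a b" "pt c d" R])
    show "R (pt a b)" unfolding R_def using step start(2) by blast
    fix z assume "z \<in> - \<Omega>"
    obtain U where U: "open U" "z \<in> U"
      "\<And>y i j. y \<in> U \<Longrightarrow> y \<in> square h (pt i j) \<Longrightarrow> z \<in> square h (pt i j)"
      using neighbourhood_meets_same_squares[of z] by metis
    have "R y" if xy: "x \<in> U" "x \<notin> \<Omega>" "y \<in> U" "R x" for x y
      unfolding R_def
    proof (intro allI impI)
      fix i j k l
      assume ij: "pt i j \<notin> T" "y \<in> square h (pt i j)" and kl: "pt k l \<in> square h (pt i j)"
      obtain i' j' where ij': "pt i' j' \<notin> T" "x \<in> square h (pt i' j')"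
        using complement_covered xy(2) by blast
      have "z \<in> square h (pt i j)" "z \<in> square h (pt i' j')"
        using U(3) xy ij ij' by auto
      \<comment> \<open>Two lattice squares with a common point have a common vertex.\<close>
      then have "i \<le> i' + 1" "i' \<le> i + 1" "j \<le> j' + 1" "j' \<le> j + 1"
        unfolding mem_square_iff by linarith+
      then have "pt (max i i') (max j j') \<in> square h (pt i j)"
        "pt (max i i') (max j j') \<in> square h (pt i' j')"
        by (auto simp: pt_mem_square_iff)
      then show "P k l"
        using \<open>R x\<close> ij ij' kl step unfolding R_def by blast
    qed
    then show "\<exists>V. openin (top_of_set (- \<Omega>)) V \<and> z \<in> V \<and> (\<forall>x\<in>V. \<forall>y\<in>V. R x \<longrightarrow> R y)"
      using U \<open>z \<in> - \<Omega>\<close> by (intro exI[of _ "- \<Omega> \<inter> U"]) (auto simp: openin_open)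
  qed (use start target in auto)
  moreover obtain i j where "pt i j \<notin> T" "pt c d \<in> square h (pt i j)"
    using complement_covered target by blast
  ultimately show ?thesis unfolding R_def by blast
qed

lemma mesh_bounded_left: obtains m where "\<And>i j. i < m \<Longrightarrow> pt i j \<notin> T"
proof -
  have "finite ((\<lambda>p. \<lfloor>X p\<rfloor>) ` T)" using finite_T by simp
  then obtain m where "\<forall>x \<in> (\<lambda>p. \<lfloor>X p\<rfloor>) ` T. m \<le> x" using bdd_below_finite bdd_below_def by metis
  then have "m \<le> i" if "pt i j \<in> T" for i j using that by fastforce
  then show ?thesis using that[of m] by force
qed

end

text \<open>
  Two squares that meet share a vertex, so their left-bottom vertices differ by lattice vectors.  The
  squares on the lattice of a given one and the remaining squares would therefore split
  the connected set \<open>closure \<Omega>\<close> into two disjoint closed sets.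
\<close>
lemma square_mesh_of_triangulation:
  assumes dom: "polygonal_domain \<Omega>" "simply_connected \<Omega>" and tri: "square_triangulation \<Omega> h T"
  obtains org where "square_mesh \<Omega> h T org"
proof -
  have d: "open \<Omega>" "bounded \<Omega>" "connected \<Omega>" "\<Omega> \<noteq> {}" "interior (closure \<Omega>) = \<Omega>"
    using dom(1) by (auto simp: polygonal_domain_def)
  have t: "h > 0" "finite T" "closure \<Omega> = (\<Union>p\<in>T. square h p)"
    using tri by (auto simp: square_triangulation_def)
  have shared: "\<exists>a. a \<in> square_vertices h p \<and> a \<in> square_vertices h q"
    if "p \<in> T" "q \<in> T" "square h p \<inter> square h q \<noteq> {}" for p q
  proof (cases "p = q")
    case True
    then show ?thesis unfolding square_vertices_def by blast
  next
    case False
    have edge: "a \<in> square_vertices h r" if "(a, b) \<in> square_edges h r" for a b r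
      using that by (auto simp: square_edges_def square_vertices_def)
    have "(\<exists>a \<in> square_vertices h p \<inter> square_vertices h q. square h p \<inter> square h q = {a}) \<or>
        (\<exists>(a, b) \<in> square_edges h p \<inter> square_edges h q.
           square h p \<inter> square h q = closed_segment a b)"
      using tri that False unfolding square_triangulation_def by blast
    then show ?thesis using edge by blast
  qed
  have vertex: "\<exists>i j::int. a = r + (h * of_int i, h * of_int j)" if "a \<in> square_vertices h r" for a r
  proof -
    have "a = r + (h * of_int 1, h * of_int 1) \<or> a = r + (h * of_int 0, h * of_int 1) \<or>
      a = r + (h * of_int 0, h * of_int 0) \<or> a = r + (h * of_int 1, h * of_int 0)"
      using that by (auto simp: square_vertices_def V_rt_def V_lt_def V_lb_def V_rb_def zero_prod_def)
    then show ?thesis by blast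
  qed
  obtain org where org: "org \<in> T" using d t by (metis UN_E closure_subset equals0I subsetD)
  define L where "L = {p. \<exists>i j::int. p = org + (h * of_int i, h * of_int j)}"
  have "org = org + (h * of_int 0, h * of_int 0)" by (simp add: zero_prod_def[symmetric])
  then have "org \<in> L" unfolding L_def by blast
  have L_step: "q \<in> L" if pq: "p \<in> T" "q \<in> T" "square h p \<inter> square h q \<noteq> {}" "p \<in> L" for p q
  proof -
    obtain a where a: "a \<in> square_vertices h p" "a \<in> square_vertices h q" using shared pq by blast
    obtain i j i' j' k l :: int where "a = p + (h * of_int i, h * of_int j)"
      "a = q + (h * of_int i', h * of_int j')" "p = org + (h * of_int k, h * of_int l)"
      using vertex[OF a(1)] vertex[OF a(2)] \<open>p \<in> L\<close> unfolding L_def by blast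
    then have "q = org + (h * of_int (k + i - i'), h * of_int (l + j - j'))"
      by (auto simp: prod_eq_iff algebra_simps)
    then show ?thesis unfolding L_def by blast
  qed
  have "T \<subseteq> L"
  proof (rule ccontr)
    assume "\<not> T \<subseteq> L"
    then obtain q where q: "q \<in> T" "q \<notin> L" by blast
    let ?A = "\<Union>p\<in>T \<inter> L. square h p" and ?B = "\<Union>p\<in>T - L. square h p"
    have closed: "closed ?A" "closed ?B" using t(2) by (auto simp: square_def closed_cbox)
    have disj: "?A \<inter> ?B = {}" using L_step by blast
    have "p \<in> square h p" for p using t(1)
      by (auto simp: square_def V_lb_def V_rt_def mem_cbox_pair)
    then have meet: "org \<in> ?A \<inter> closure \<Omega>" "q \<in> ?B \<inter> closure \<Omega>"
      using org q t(3) \<open>org \<in> L\<close> by blast+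
    have cover: "closure \<Omega> \<subseteq> ?A \<union> ?B" using t(3) by blast
    have "\<not> connected (closure \<Omega>)"
      unfolding connected_closed using closed disj cover meet
      by (intro notI; elim notE; intro exI[of _ ?A] exI[of _ ?B] conjI) auto
    then show False using d connected_imp_connected_closure by blast
  qed
  then have "square_mesh \<Omega> h T org"
    using d t simply_connected_imp_connected_complement dom(2)
    unfolding L_def by unfold_locales auto
  then show ?thesis using that by blast
qed

section \<open>Values at edge midpoints\<close>

lemma tendsto_within_finite_UN:
  assumes "finite I"
  shows "(f \<longlongrightarrow> l) (at a within (\<Union>i\<in>I. S i)) \<longleftrightarrow> (\<forall>i\<in>I. (f \<longlongrightarrow> l) (at a within S i))"
proof
  assume "(f \<longlongrightarrow> l) (at a within (\<Union>i\<in>I. S i))"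
  then show "\<forall>i\<in>I. (f \<longlongrightarrow> l) (at a within S i)"
    by (meson UN_upper tendsto_within_subset)
next
  show "\<forall>i\<in>I. (f \<longlongrightarrow> l) (at a within S i) \<Longrightarrow> (f \<longlongrightarrow> l) (at a within (\<Union>i\<in>I. S i))"
    using assms by (induction I) (auto intro: Lim_Un)
qed

lemma of_int_between_iff:
  "real_of_int k \<le> of_int i + 1 / 2 \<and> of_int i + 1 / 2 \<le> real_of_int k + 1 \<longleftrightarrow> k = i"
  "real_of_int k \<le> of_int i \<and> of_int i \<le> real_of_int k + 1 \<longleftrightarrow> k = i \<or> k = i - 1"
  by linarith+

context square_mesh begin

definition hedge :: "int \<Rightarrow> int \<Rightarrow> point \<times> point" where "hedge i j = (pt i j, pt (i + 1) j)"
definition vedge :: "int \<Rightarrow> int \<Rightarrow> point \<times> point" where "vedge i j = (pt i j, pt i (j + 1))"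

lemma hedge_in_mesh_iff: "hedge i j \<in> mesh_edges h T \<longleftrightarrow> pt i j \<in> T \<or> pt i (j - 1) \<in> T"
proof
  assume "hedge i j \<in> mesh_edges h T"
  then obtain p where "p \<in> T" "hedge i j \<in> square_edges h p" by (auto simp: mesh_edges_def)
  moreover obtain k l where "p = pt k l" using T_cases \<open>p \<in> T\<close> by blast
  ultimately show "pt i j \<in> T \<or> pt i (j - 1) \<in> T"
    by (auto simp: square_edges_def hedge_def)
next
  have "hedge i j \<in> square_edges h (pt i j)" "hedge i j \<in> square_edges h (pt i (j - 1))"
    by (auto simp: square_edges_def hedge_def)
  then show "pt i j \<in> T \<or> pt i (j - 1) \<in> T \<Longrightarrow> hedge i j \<in> mesh_edges h T"
    by (auto simp: mesh_edges_def)
qed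

lemma vedge_in_mesh_iff: "vedge i j \<in> mesh_edges h T \<longleftrightarrow> pt i j \<in> T \<or> pt (i - 1) j \<in> T"
proof
  assume "vedge i j \<in> mesh_edges h T"
  then obtain p where "p \<in> T" "vedge i j \<in> square_edges h p" by (auto simp: mesh_edges_def)
  moreover obtain k l where "p = pt k l" using T_cases \<open>p \<in> T\<close> by blast
  ultimately show "pt i j \<in> T \<or> pt (i - 1) j \<in> T"
    by (auto simp: square_edges_def vedge_def)
next
  have "vedge i j \<in> square_edges h (pt i j)" "vedge i j \<in> square_edges h (pt (i - 1) j)"
    by (auto simp: square_edges_def vedge_def)
  then show "pt i j \<in> T \<or> pt (i - 1) j \<in> T \<Longrightarrow> vedge i j \<in> mesh_edges h T"
    by (auto simp: mesh_edges_def)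
qed

lemma mesh_edge_cases:
  assumes "e \<in> mesh_edges h T"
  obtains i j where "e = hedge i j" | i j where "e = vedge i j"
proof -
  obtain p where "p \<in> T" "e \<in> square_edges h p" using assms by (auto simp: mesh_edges_def)
  moreover obtain i j where "p = pt i j" using T_cases \<open>p \<in> T\<close> by blast
  ultimately have "e = hedge i j \<or> e = hedge i (j + 1) \<or> e = vedge i j \<or> e = vedge (i + 1) j"
    by (auto simp: square_edges_def hedge_def vedge_def)
  then show ?thesis using that by blast
qed

lemma XY_midpoint [simp]:
  "X (midpoint z w) = (X z + X w) / 2" "Y (midpoint z w) = (Y z + Y w) / 2"
  using h_pos by (auto simp: X_def Y_def midpoint_def field_simps)

text \<open>
  The limit along the union of the open cells exists iff the limits from the finitely many cells agree.  From
  a cell whose closure misses the point, every limit statement holds trivially; from the others, the limit is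
  the value of the continuous extension.  Scalar functions and vector fields are covered at once.
\<close>
lemma midpoint_value_iff:
  fixes v :: "point \<Rightarrow> 'a::t2_space"
  assumes v: "\<And>i j z. pt i j \<in> T \<Longrightarrow> z \<in> open_square h (pt i j) \<Longrightarrow> v z = A i j (X z) (Y z)"
    and cont: "\<And>i j. continuous_on UNIV (\<lambda>z. A i j (X z) (Y z))"
  shows "has_midpoint_value h T v e c \<longleftrightarrow>
    (\<forall>i j. pt i j \<in> T \<longrightarrow> midpoint (fst e) (snd e) \<in> square h (pt i j) \<longrightarrow>
       A i j (X (midpoint (fst e) (snd e))) (Y (midpoint (fst e) (snd e))) = c)"
proof -
  define m where "m = midpoint (fst e) (snd e)"
  have cell: "(v \<longlongrightarrow> c) (at m within open_square h (pt i j)) \<longleftrightarrow>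
      (m \<in> square h (pt i j) \<longrightarrow> A i j (X m) (Y m) = c)" if "pt i j \<in> T" for i j
  proof -
    let ?F = "at m within open_square h (pt i j)"
    have "isCont (\<lambda>z. A i j (X z) (Y z)) m"
      using cont by (metis UNIV_I continuous_on_eq_continuous_at open_UNIV)
    then have "((\<lambda>z. A i j (X z) (Y z)) \<longlongrightarrow> A i j (X m) (Y m)) ?F"
      unfolding isCont_def by (rule tendsto_within_subset) simp
    moreover have "\<forall>\<^sub>F z in ?F. A i j (X z) (Y z) = v z"
      using v[OF that] by (auto simp: eventually_at_filter)
    ultimately have lim: "(v \<longlongrightarrow> A i j (X m) (Y m)) ?F"
      using tendsto_cong by fastforce
    have bot: "?F = bot \<longleftrightarrow> m \<notin> square h (pt i j)"
      unfolding trivial_limit_within closure_open_square[symmetric] closure_def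
      using interior_limit_point[of m "open_square h (pt i j)"] by (auto simp: interior_open)
    show ?thesis using lim bot tendsto_unique[OF _ lim] tendsto_bot by metis
  qed
  have "(\<forall>p\<in>T. P p) \<longleftrightarrow> (\<forall>i j. pt i j \<in> T \<longrightarrow> P (pt i j))" for P
    using T_cases by metis
  then show ?thesis
    unfolding has_midpoint_value_def m_def[symmetric] mesh_cells_def tendsto_within_finite_UN[OF finite_T]
    using cell by simp
qed

lemma hedge_value_iff:
  fixes v :: "point \<Rightarrow> 'a::t2_space"
  assumes "\<And>i j z. pt i j \<in> T \<Longrightarrow> z \<in> open_square h (pt i j) \<Longrightarrow> v z = A i j (X z) (Y z)"
    and "\<And>i j. continuous_on UNIV (\<lambda>z. A i j (X z) (Y z))"
  shows "has_midpoint_value h T v (hedge i j) c \<longleftrightarrow>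
    (pt i j \<in> T \<longrightarrow> A i j (of_int i + 1 / 2) (of_int j) = c) \<and>
    (pt i (j - 1) \<in> T \<longrightarrow> A i (j - 1) (of_int i + 1 / 2) (of_int j) = c)"
proof -
  let ?m = "midpoint (fst (hedge i j)) (snd (hedge i j))"
  have m: "X ?m = of_int i + 1 / 2" "Y ?m = of_int j" by (auto simp: hedge_def)
  have "?m \<in> square h (pt k l) \<longleftrightarrow> k = i \<and> (l = j \<or> l = j - 1)" for k l
    unfolding mem_square_iff m using of_int_between_iff(1)[of k i] of_int_between_iff(2)[of l j] by metis
  then show ?thesis
    using midpoint_value_iff[of v A "hedge i j" c, OF assms] unfolding m by auto
qed

lemma vedge_value_iff:
  fixes v :: "point \<Rightarrow> 'a::t2_space"
  assumes "\<And>i j z. pt i j \<in> T \<Longrightarrow> z \<in> open_square h (pt i j) \<Longrightarrow> v z = A i j (X z) (Y z)"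
    and "\<And>i j. continuous_on UNIV (\<lambda>z. A i j (X z) (Y z))"
  shows "has_midpoint_value h T v (vedge i j) c \<longleftrightarrow>
    (pt i j \<in> T \<longrightarrow> A i j (of_int i) (of_int j + 1 / 2) = c) \<and>
    (pt (i - 1) j \<in> T \<longrightarrow> A (i - 1) j (of_int i) (of_int j + 1 / 2) = c)"
proof -
  let ?m = "midpoint (fst (vedge i j)) (snd (vedge i j))"
  have m: "X ?m = of_int i" "Y ?m = of_int j + 1 / 2" by (auto simp: vedge_def)
  have "?m \<in> square h (pt k l) \<longleftrightarrow> l = j \<and> (k = i \<or> k = i - 1)" for k l
    unfolding mem_square_iff m using of_int_between_iff(2)[of k i] of_int_between_iff(1)[of l j] by metis
  then show ?thesis
    using midpoint_value_iff[of v A "vedge i j" c, OF assms] unfolding m by auto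
qed

text \<open>
  A mesh edge lies in the closure of the domain, and a cell outside the mesh misses the domain;
  hence an edge of both lies in the frontier.  This is why values prescribed on the mesh can be
  extended by zero to all lattice edges.
\<close>
lemma edge_of_non_mesh_square_is_boundary:
  assumes "(a, b) \<in> mesh_edges h T" and "a \<in> square h (pt i j)" "b \<in> square h (pt i j)" "pt i j \<notin> T"
  shows "boundary_edge \<Omega> (a, b)"
proof -
  have conv: "convex (square h p)" for p by (simp add: square_def)
  obtain p where p: "p \<in> T" "(a, b) \<in> square_edges h p" using assms(1) by (auto simp: mesh_edges_def)
  obtain k l where kl: "p = pt k l" using T_cases p by blast
  have "a \<in> square h p \<and> b \<in> square h p"
    using p(2) unfolding kl square_edges_def V_pt by (auto simp: pt_mem_square_iff)
  then have "closed_segment a b \<subseteq> closure \<Omega>"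
    using closure_domain p(1) closed_segment_subset[OF _ _ conv[of p], of a b] by auto
  moreover have "closed_segment a b \<inter> \<Omega> = {}"
    using non_mesh_square_disjoint[OF assms(4)] closed_segment_subset[OF assms(2,3) conv] by blast
  ultimately show ?thesis
    unfolding boundary_edge_def frontier_def interior_open[OF open_domain] by auto
qed

section \<open>Scalar nonconforming functions and their vertex values\<close>

definition slope_x :: "(int \<Rightarrow> int \<Rightarrow> real) \<Rightarrow> int \<Rightarrow> int \<Rightarrow> real" where
  "slope_x f i j = f (i + 1) j + f (i + 1) (j + 1) - f i j - f i (j + 1)"

definition slope_y :: "(int \<Rightarrow> int \<Rightarrow> real) \<Rightarrow> int \<Rightarrow> int \<Rightarrow> real" where
  "slope_y f i j = f i (j + 1) + f (i + 1) (j + 1) - f i j - f (i + 1) j"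

text \<open>
  The affine function on the cell \<open>(i, j)\<close> whose value at the midpoint of each edge is the sum, not the
  mean, of the values of \<open>f\<close> at the endpoints.  With sums, the function with vertex
  values \<open>c\<close> at one interior vertex and zero elsewhere has the value \<open>c\<close> at the midpoints of
  the edges that meet this vertex, as \<^const>\<open>psi\<close> requires.
\<close>
definition affine_piece :: "(int \<Rightarrow> int \<Rightarrow> real) \<Rightarrow> int \<Rightarrow> int \<Rightarrow> real \<Rightarrow> real \<Rightarrow> real" where
  "affine_piece f i j x y =
     (f i j + f (i + 1) j + f i (j + 1) + f (i + 1) (j + 1)) / 2 +
     slope_x f i j * (x - of_int i - 1 / 2) + slope_y f i j * (y - of_int j - 1 / 2)"

definition interp :: "(int \<Rightarrow> int \<Rightarrow> real) \<Rightarrow> point \<Rightarrow> real" where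
  "interp f z = (if z \<in> mesh_cells h T then affine_piece f \<lfloor>X z\<rfloor> \<lfloor>Y z\<rfloor> (X z) (Y z) else 0)"

definition vanishes_outside :: "(int \<Rightarrow> int \<Rightarrow> real) \<Rightarrow> bool" where
  "vanishes_outside f \<longleftrightarrow> (\<forall>i j. pt i j \<notin> \<Omega> \<longrightarrow> f i j = 0)"

lemma vanishes_outsideD: "vanishes_outside f \<Longrightarrow> pt i j \<notin> \<Omega> \<Longrightarrow> f i j = 0"
  by (simp add: vanishes_outside_def)

lemma mesh_cells_iff: "z \<in> mesh_cells h T \<longleftrightarrow> (\<exists>i j. pt i j \<in> T \<and> z \<in> open_square h (pt i j))"
  unfolding mesh_cells_def using T_cases by (metis UN_iff)

lemma interp_on_cell:
  assumes "pt i j \<in> T" "z \<in> open_square h (pt i j)"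
  shows "interp f z = affine_piece f i j (X z) (Y z)"
proof -
  have "\<lfloor>X z\<rfloor> = i" "\<lfloor>Y z\<rfloor> = j"
    using assms(2) by (auto simp: mem_open_square_iff floor_eq_iff)
  then show ?thesis using assms mesh_cells_iff by (auto simp: interp_def)
qed

lemma continuous_affine_piece: "continuous_on A (\<lambda>z. affine_piece f i j (X z) (Y z))"
  unfolding affine_piece_def by (intro continuous_intros)

lemma affine_piece_edges:
  "affine_piece f i j (of_int i + 1 / 2) (of_int j) = f i j + f (i + 1) j"
  "affine_piece f i (j - 1) (of_int i + 1 / 2) (of_int j) = f i j + f (i + 1) j"
  "affine_piece f i j (of_int i) (of_int j + 1 / 2) = f i j + f i (j + 1)"
  "affine_piece f (i - 1) j (of_int i) (of_int j + 1 / 2) = f i j + f i (j + 1)"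
  by (auto simp: affine_piece_def slope_x_def slope_y_def field_simps)

lemma interp_hedge_iff:
  "has_midpoint_value h T (interp f) (hedge i j) c \<longleftrightarrow>
     (hedge i j \<in> mesh_edges h T \<longrightarrow> f i j + f (i + 1) j = c)"
  by (subst hedge_value_iff[of _ "affine_piece f"])
    (auto simp: interp_on_cell continuous_affine_piece affine_piece_edges hedge_in_mesh_iff)

lemma interp_vedge_iff:
  "has_midpoint_value h T (interp f) (vedge i j) c \<longleftrightarrow>
     (vedge i j \<in> mesh_edges h T \<longrightarrow> f i j + f i (j + 1) = c)"
  by (subst vedge_value_iff[of _ "affine_piece f"])
    (auto simp: interp_on_cell continuous_affine_piece affine_piece_edges vedge_in_mesh_iff)

lemma interp_bounded: obtains B where "\<And>z. \<bar>interp f z\<bar> \<le> B"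
proof -
  have "bounded (interp f ` (\<Union>p\<in>T. open_square h p))"
    unfolding image_UN
  proof (intro bounded_UN finite_T ballI)
    fix p assume "p \<in> T"
    then obtain i j where p: "p = pt i j" using T_cases by blast
    have "compact ((\<lambda>z. affine_piece f i j (X z) (Y z)) ` square h p)"
      by (intro compact_continuous_image continuous_affine_piece) (simp add: square_def)
    moreover have "interp f ` open_square h p \<subseteq> (\<lambda>z. affine_piece f i j (X z) (Y z)) ` square h p"
      using interp_on_cell closure_open_square closure_subset \<open>p \<in> T\<close> unfolding p by fastforce
    ultimately show "bounded (interp f ` open_square h p)"
      using bounded_subset compact_imp_bounded by blast
  qed
  then obtain B where B: "\<And>z. z \<in> mesh_cells h T \<Longrightarrow> \<bar>interp f z\<bar> \<le> B"
    unfolding bounded_iff mesh_cells_def by auto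
  then have "\<bar>interp f z\<bar> \<le> max B 0" for z
    using B[of z] by (cases "z \<in> mesh_cells h T") (simp_all add: interp_def le_max_iff_disj)
  then show ?thesis using that by blast
qed

lemma open_mesh_cells: "open (mesh_cells h T)"
  by (auto simp: mesh_cells_def)

lemma interp_L2: "L2 \<Omega> (interp f)"
proof -
  have "continuous_on (mesh_cells h T) (interp f)"
    unfolding mesh_cells_def
  proof (intro continuous_on_open_UN)
    fix p assume "p \<in> T"
    then obtain i j where "p = pt i j" using T_cases by blast
    then show "continuous_on (open_square h p) (interp f)"
      using continuous_affine_piece[of "open_square h p" f i j] \<open>p \<in> T\<close>
      by (simp add: interp_on_cell cong: continuous_on_cong)
  qed simp
  then have "(\<lambda>z. indicator (mesh_cells h T) z *\<^sub>R interp f z) \<in> borel_measurable borel"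
    using open_mesh_cells by (intro borel_measurable_continuous_on_indicator) auto
  moreover have "(\<lambda>z. indicator (mesh_cells h T) z *\<^sub>R interp f z) = interp f"
    by (auto simp: interp_def fun_eq_iff)
  ultimately have "interp f \<in> borel_measurable lborel" by simp
  then have meas: "interp f \<in> borel_measurable lebesgue" by (rule measurable_completion)
  have Omega: "\<Omega> \<in> lmeasurable"
    using lmeasurable_open bounded_domain open_domain by blast
  then have sets: "\<Omega> \<in> sets lebesgue" by auto
  obtain B where B: "\<And>z. \<bar>interp f z\<bar> \<le> B" using interp_bounded[of f] by metis
  have "set_borel_measurable lebesgue \<Omega> (interp f)"
    unfolding set_borel_measurable_def using meas sets by measurable
  moreover have "set_integrable lebesgue \<Omega> (\<lambda>z. (interp f z)\<^sup>2)"
    unfolding set_integrable_def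
  proof (rule integrableI_bounded_set_indicator[OF sets])
    show "(\<lambda>z. (interp f z)\<^sup>2) \<in> borel_measurable lebesgue" using meas by measurable
    show "emeasure lebesgue \<Omega> < \<infinity>" using Omega by (auto simp: fmeasurable_def)
    show "AE z in lebesgue. z \<in> \<Omega> \<longrightarrow> norm ((interp f z)\<^sup>2) \<le> B\<^sup>2"
      using power_mono[OF B abs_ge_zero, of _ 2] by simp
  qed
  ultimately show ?thesis by (simp add: L2_def)
qed

lemma pt_notin_domain_of_boundary:
  assumes "boundary_edge \<Omega> (a, b)"
  shows "a \<notin> \<Omega>" "b \<notin> \<Omega>"
  using assms open_domain unfolding boundary_edge_def frontier_def by (auto simp: interior_open)

lemma interp_in_NC0:
  assumes "vanishes_outside f"
  shows "interp f \<in> NC0 \<Omega> h T"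
proof -
  have val: "\<exists>c. has_midpoint_value h T (interp f) e c" if "e \<in> mesh_edges h T" for e
    using that by (elim mesh_edge_cases) (auto simp: interp_hedge_iff interp_vedge_iff)
  have bd: "has_midpoint_value h T (interp f) e 0" if "e \<in> mesh_edges h T" "boundary_edge \<Omega> e" for e
    using that(1)
  proof (cases rule: mesh_edge_cases)
    case (1 i j)
    then have "pt i j \<notin> \<Omega>" "pt (i + 1) j \<notin> \<Omega>"
      using pt_notin_domain_of_boundary that(2) unfolding hedge_def by blast+
    then show ?thesis using 1 vanishes_outsideD[OF assms] by (simp add: interp_hedge_iff)
  next
    case (2 i j)
    then have "pt i j \<notin> \<Omega>" "pt i (j + 1) \<notin> \<Omega>"
      using pt_notin_domain_of_boundary that(2) unfolding vedge_def by blast+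
    then show ?thesis using 2 vanishes_outsideD[OF assms] by (simp add: interp_vedge_iff)
  qed
  have aff: "\<exists>\<alpha> \<beta> \<gamma>. \<forall>(x, y)\<in>open_square h p. interp f (x, y) = \<alpha> + \<beta> * x + \<gamma> * y" if pT: "p \<in> T" for p
  proof -
    obtain i j where p: "p = pt i j" using T_cases pT by blast
    let ?\<alpha> = "affine_piece f i j (- fst org / h) (- snd org / h)"
    have "affine_piece f i j (X (x, y)) (Y (x, y)) = ?\<alpha> + slope_x f i j / h * x + slope_y f i j / h * y" for x y
      using h_pos by (simp add: affine_piece_def X_def Y_def field_simps)
    then show ?thesis
      using interp_on_cell pT unfolding p
      by (intro exI[of _ ?\<alpha>] exI[of _ "slope_x f i j / h"] exI[of _ "slope_y f i j / h"]) auto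
  qed
  show ?thesis
    unfolding NC0_def NC_def using interp_L2 val bd aff by (auto simp: interp_def)
qed

text \<open>
  Equal sums over horizontal edges make the difference of two vertex functions alternate in sign along each
  row of the lattice, and each row leaves the domain to the left.
\<close>
lemma vertex_values_unique:
  assumes f: "vanishes_outside f" "vanishes_outside f'"
    and eq: "\<And>i j. pt i j \<in> T \<Longrightarrow> f i j + f (i + 1) j = f' i j + f' (i + 1) j"
  shows "f = f'"
proof -
  obtain m where m: "\<And>i j. i < m \<Longrightarrow> pt i j \<notin> T" using mesh_bounded_left by metis
  define d where "d i j = f i j - f' i j" for i j
  have out: "d i j = 0" if "pt i j \<notin> \<Omega>" for i j
    using f that by (simp add: d_def vanishes_outside_def)
  have step: "d (i + 1) j = - d i j" for i j
  proof (cases "pt i j \<in> T")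
    case True
    then show ?thesis using eq[of i j] by (simp add: d_def)
  next
    case False
    then have "pt i j \<notin> \<Omega>" "pt (i + 1) j \<notin> \<Omega>" by (auto simp: vertex_in_domain_iff)
    then show ?thesis using out by simp
  qed
  have "d i j = 0" for i j
  proof (cases "m \<le> i")
    case True
    then show ?thesis
    proof (induction i rule: int_ge_induct)
      case base
      show ?case using m[of "m - 1" j] by (intro out) (simp add: vertex_in_domain_iff)
    next
      case (step i)
      then show ?case using \<open>d (i + 1) j = - d i j\<close> by simp
    qed
  next
    case False
    then show ?thesis using m[of i j] by (intro out) (simp add: vertex_in_domain_iff)
  qed
  then show ?thesis by (auto simp: d_def fun_eq_iff)
qed


text \<open>
  The midpoint values of \<open>v\<close>, extended by zero, satisfy \<open>c\<^sub>1 + c\<^sub>3 = c\<^sub>2 + c\<^sub>4\<close> on every lattice cell,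
  hence they are sums of vertex values \<open>f\<close> that vanish far to the left.  Around a cell outside the
  mesh all edge values are zero, so \<open>f = 0\<close> passes from any vertex of this cell to the others.
\<close>
lemma NC0_imp_interp:
  assumes "v \<in> NC0 \<Omega> h T"
  obtains f where "vanishes_outside f" "v = interp f"
proof -
  have affine: "\<exists>\<alpha> \<beta> \<gamma>. \<forall>(x, y)\<in>open_square h p. v (x, y) = \<alpha> + \<beta> * x + \<gamma> * y" if "p \<in> T" for p
    using assms that by (simp add: NC0_def NC_def)
  have midval: "\<exists>c. has_midpoint_value h T v e c" if "e \<in> mesh_edges h T" for e
    using assms that by (simp add: NC0_def NC_def)
  have boundary: "has_midpoint_value h T v e 0" if "e \<in> mesh_edges h T" "boundary_edge \<Omega> e" for e
    using assms that unfolding NC0_def by blast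
  have outside: "v z = 0" if "z \<notin> mesh_cells h T" for z
    using assms that by (cases z) (simp add: NC0_def NC_def)
  \<comment> \<open>The affine pieces in lattice coordinates.\<close>
  have "\<exists>\<alpha> \<beta> \<gamma>. pt i j \<in> T \<longrightarrow> (\<forall>z\<in>open_square h (pt i j). v z = \<alpha> + \<beta> * X z + \<gamma> * Y z)" for i j
  proof (cases "pt i j \<in> T")
    case True
    then obtain \<alpha> \<beta> \<gamma> where "\<forall>(x, y)\<in>open_square h (pt i j). v (x, y) = \<alpha> + \<beta> * x + \<gamma> * y"
      using affine by blast
    then have "\<forall>z\<in>open_square h (pt i j). v z = \<alpha> + \<beta> * fst z + \<gamma> * snd z" by auto
    moreover have "\<alpha> + \<beta> * fst z + \<gamma> * snd z =
        (\<alpha> + \<beta> * fst org + \<gamma> * snd org) + (\<beta> * h) * X z + (\<gamma> * h) * Y z" for z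
      using h_pos by (simp add: X_def Y_def field_simps)
    ultimately show ?thesis by metis
  qed blast
  then obtain \<alpha> \<beta> \<gamma> where
    "\<forall>i j. pt i j \<in> T \<longrightarrow> (\<forall>z\<in>open_square h (pt i j). v z = \<alpha> i j + \<beta> i j * X z + \<gamma> i j * Y z)"
    by metis
  moreover define A where "A i j x y = \<alpha> i j + \<beta> i j * x + \<gamma> i j * y" for i j x y
  ultimately have vA: "v z = A i j (X z) (Y z)" if "pt i j \<in> T" "z \<in> open_square h (pt i j)" for i j z
    using that by auto
  have contA: "continuous_on UNIV (\<lambda>z. A i j (X z) (Y z))" for i j
    unfolding A_def by (intro continuous_intros)
  note hval = hedge_value_iff[of v A, OF vA contA] and vval = vedge_value_iff[of v A, OF vA contA]

  \<comment> \<open>The values on horizontal edges, zero on each edge with a side outside the mesh.\<close>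
  have "\<exists>c. (pt i j \<in> T \<longrightarrow> A i j (of_int i + 1 / 2) (of_int j) = c) \<and>
      (pt i (j - 1) \<in> T \<longrightarrow> A i (j - 1) (of_int i + 1 / 2) (of_int j) = c) \<and>
      (pt i j \<notin> T \<or> pt i (j - 1) \<notin> T \<longrightarrow> c = 0)" for i j
  proof (cases "hedge i j \<in> mesh_edges h T \<and> pt i j \<in> T \<and> pt i (j - 1) \<in> T")
    case True
    then obtain c where "has_midpoint_value h T v (hedge i j) c" using midval by blast
    then show ?thesis using True hval[of i j c] by (intro exI[of _ c]) simp
  next
    case False
    have "has_midpoint_value h T v (hedge i j) 0"
    proof (cases "hedge i j \<in> mesh_edges h T")
      case True
      then have "pt i j \<notin> T \<or> pt i (j - 1) \<notin> T" using False by blast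
      then have "boundary_edge \<Omega> (hedge i j)"
        using edge_of_non_mesh_square_is_boundary[of "pt i j" "pt (i + 1) j" i j]
          edge_of_non_mesh_square_is_boundary[of "pt i j" "pt (i + 1) j" i "j - 1"] True
        unfolding hedge_def by (auto simp: pt_mem_square_iff)
      then show ?thesis using boundary True by blast
    qed (simp add: hval hedge_in_mesh_iff)
    then show ?thesis using hval[of i j 0] by (intro exI[of _ 0]) simp
  qed
  then obtain H where H: "\<And>i j. pt i j \<in> T \<Longrightarrow> A i j (of_int i + 1 / 2) (of_int j) = H i j"
    "\<And>i j. pt i (j - 1) \<in> T \<Longrightarrow> A i (j - 1) (of_int i + 1 / 2) (of_int j) = H i j"
    "\<And>i j. pt i j \<notin> T \<or> pt i (j - 1) \<notin> T \<Longrightarrow> H i j = 0"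
    by metis
  \<comment> \<open>The same for vertical edges.\<close>
  have "\<exists>c. (pt i j \<in> T \<longrightarrow> A i j (of_int i) (of_int j + 1 / 2) = c) \<and>
      (pt (i - 1) j \<in> T \<longrightarrow> A (i - 1) j (of_int i) (of_int j + 1 / 2) = c) \<and>
      (pt i j \<notin> T \<or> pt (i - 1) j \<notin> T \<longrightarrow> c = 0)" for i j
  proof (cases "vedge i j \<in> mesh_edges h T \<and> pt i j \<in> T \<and> pt (i - 1) j \<in> T")
    case True
    then obtain c where "has_midpoint_value h T v (vedge i j) c" using midval by blast
    then show ?thesis using True vval[of i j c] by (intro exI[of _ c]) simp
  next
    case False
    have "has_midpoint_value h T v (vedge i j) 0"
    proof (cases "vedge i j \<in> mesh_edges h T")
      case True
      then have "pt i j \<notin> T \<or> pt (i - 1) j \<notin> T" using False by blast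
      then have "boundary_edge \<Omega> (vedge i j)"
        using edge_of_non_mesh_square_is_boundary[of "pt i j" "pt i (j + 1)" i j]
          edge_of_non_mesh_square_is_boundary[of "pt i j" "pt i (j + 1)" "i - 1" j] True
        unfolding vedge_def by (auto simp: pt_mem_square_iff)
      then show ?thesis using boundary True by blast
    qed (simp add: vval vedge_in_mesh_iff)
    then show ?thesis using vval[of i j 0] by (intro exI[of _ 0]) simp
  qed
  then obtain W where W: "\<And>i j. pt i j \<in> T \<Longrightarrow> A i j (of_int i) (of_int j + 1 / 2) = W i j"
    "\<And>i j. pt (i - 1) j \<in> T \<Longrightarrow> A (i - 1) j (of_int i) (of_int j + 1 / 2) = W i j"
    "\<And>i j. pt i j \<notin> T \<or> pt (i - 1) j \<notin> T \<Longrightarrow> W i j = 0"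
    by metis

  obtain m where m: "\<And>i j. i < m \<Longrightarrow> pt i j \<notin> T" using mesh_bounded_left by metis
  have compat: "H i (j + 1) - W i j = W (i + 1) j - H i j" for i j
  proof (cases "pt i j \<in> T")
    case True
    then have "H i j = A i j (of_int i + 1 / 2) (of_int j)" "W i j = A i j (of_int i) (of_int j + 1 / 2)"
      "H i (j + 1) = A i j (of_int i + 1 / 2) (of_int (j + 1))"
      "W (i + 1) j = A i j (of_int (i + 1)) (of_int j + 1 / 2)"
      using H(1)[of i j] W(1)[of i j] H(2)[of i "j + 1"] W(2)[of "i + 1" j] by simp_all
    then show ?thesis by (simp add: A_def field_simps)
  qed (use H(3)[of i j] W(3)[of i j] H(3)[of i "j + 1"] W(3)[of "i + 1" j] in simp)
  obtain f where fH: "\<And>i j. f (i + 1) j = H i j - f i j" and fW: "\<And>i j. f i (j + 1) = W i j - f i j"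
    and left: "\<And>i j. i \<le> m \<Longrightarrow> f i j = 0"
  proof (rule lattice_potential[of 0 H 1 "- 1" W 0 m])
    show "H (i + 0) (j + 1) + - 1 * W i j = W (i + 1) (j + 0) + - 1 * H i j" for i j
      using compat[of i j] by simp
  qed (use m H(3) W(3) in auto)
  have f_out: "vanishes_outside f"
    unfolding vanishes_outside_def
  proof (intro allI impI)
    fix c d assume "pt c d \<notin> \<Omega>"
    have start: "pt m 0 \<notin> \<Omega>" "f m 0 = 0"
      using m[of "m - 1" 0] left by (auto simp: vertex_in_domain_iff)
    have "f k' l' = 0"
      if "pt i j \<notin> T" "pt k l \<in> square h (pt i j)" "pt k' l' \<in> square h (pt i j)" "f k l = 0"
      for i j k l k' l'
    proof -
      have "f (i + 1) j = - f i j" "f i (j + 1) = - f i j" "f (i + 1) (j + 1) = - f (i + 1) j"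
        using fH[of i j] fW[of i j] fW[of "i + 1" j] H(3)[of i j] W(3)[of i j] W(3)[of "i + 1" j]
          that(1) by auto
      then show ?thesis using that by (auto simp: pt_mem_square_iff)
    qed
    then show "f c d = 0"
      using propagate_over_complement[where P = "\<lambda>k l. f k l = 0"] start \<open>pt c d \<notin> \<Omega>\<close> by blast
  qed
  have "v z = interp f z" for z
  proof (cases "z \<in> mesh_cells h T")
    case True
    then obtain i j where ij: "pt i j \<in> T" "z \<in> open_square h (pt i j)" by (auto simp: mesh_cells_iff)
    have edges: "f i j + f (i + 1) j = A i j (of_int i + 1 / 2) (of_int j)"
      "f i j + f i (j + 1) = A i j (of_int i) (of_int j + 1 / 2)"
      "f i (j + 1) + f (i + 1) (j + 1) = A i j (of_int i + 1 / 2) (of_int j + 1)"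
      "f (i + 1) j + f (i + 1) (j + 1) = A i j (of_int i + 1) (of_int j + 1 / 2)"
      using H(1)[of i j] W(1)[of i j] H(2)[of i "j + 1"] W(2)[of "i + 1" j] ij(1)
        fH[of i j] fW[of i j] fH[of i "j + 1"] fW[of "i + 1" j] by simp_all
    \<comment> \<open>An affine function on a cell is determined by its values at the four midpoints.\<close>
    have "slope_x f i j = \<beta> i j" "slope_y f i j = \<gamma> i j"
      using edges by (auto simp: slope_x_def slope_y_def A_def algebra_simps)
    moreover have "(f i j + f (i + 1) j + f i (j + 1) + f (i + 1) (j + 1)) / 2 =
        \<alpha> i j + \<beta> i j * (of_int i + 1 / 2) + \<gamma> i j * (of_int j + 1 / 2)"
      using edges by (auto simp: A_def algebra_simps)
    ultimately have "affine_piece f i j x y = A i j x y" for x y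
      by (simp add: affine_piece_def A_def algebra_simps)
    then show ?thesis using vA interp_on_cell ij by simp
  next
    case False
    then show ?thesis using outside by (simp add: interp_def)
  qed
  then show ?thesis using that f_out by blast
qed

section \<open>Vector fields, stream functions and the basis\<close>

lemma interp_add: "interp (\<lambda>i j. f i j + g i j) z = interp f z + interp g z"
  by (simp add: interp_def affine_piece_def slope_x_def slope_y_def field_simps)

lemma interp_scale: "interp (\<lambda>i j. c * f i j) z = c * interp f z"
  by (simp add: interp_def affine_piece_def slope_x_def slope_y_def field_simps)

definition vinterp :: "(int \<Rightarrow> int \<Rightarrow> real) \<Rightarrow> (int \<Rightarrow> int \<Rightarrow> real) \<Rightarrow> point \<Rightarrow> real \<times> real" where
  "vinterp a b z = (interp a z, interp b z)"

lemma vinterp_add: "vinterp a b + vinterp a' b' = vinterp (\<lambda>i j. a i j + a' i j) (\<lambda>i j. b i j + b' i j)"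
  by (simp add: vinterp_def interp_add fun_eq_iff)

lemma vinterp_scale: "c *\<^sub>R vinterp a b = vinterp (\<lambda>i j. c * a i j) (\<lambda>i j. c * b i j)"
  by (simp add: vinterp_def interp_scale scaleR_fun_def fun_eq_iff)

lemma vinterp_zero: "vinterp (\<lambda>i j. 0) (\<lambda>i j. 0) = 0"
  by (simp add: vinterp_def interp_def affine_piece_def slope_x_def slope_y_def fun_eq_iff zero_prod_def)

lemma NC0_vec_iff:
  "v \<in> NC0_vec \<Omega> h T \<longleftrightarrow> (\<exists>a b. vanishes_outside a \<and> vanishes_outside b \<and> v = vinterp a b)"
proof
  assume "v \<in> NC0_vec \<Omega> h T"
  then have "(\<lambda>z. fst (v z)) \<in> NC0 \<Omega> h T" "(\<lambda>z. snd (v z)) \<in> NC0 \<Omega> h T" by (auto simp: NC0_vec_def)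
  then obtain a b where "vanishes_outside a" "(\<lambda>z. fst (v z)) = interp a"
    "vanishes_outside b" "(\<lambda>z. snd (v z)) = interp b"
    using NC0_imp_interp by metis
  moreover from this have "v = vinterp a b" by (auto simp: vinterp_def fun_eq_iff prod_eq_iff)
  ultimately show "\<exists>a b. vanishes_outside a \<and> vanishes_outside b \<and> v = vinterp a b" by blast
qed (auto simp: NC0_vec_def vinterp_def interp_in_NC0)

lemma interp_inj:
  assumes "vanishes_outside f" "vanishes_outside f'" "interp f = interp f'"
  shows "f = f'"
proof (rule vertex_values_unique[OF assms(1,2)])
  fix i j assume "pt i j \<in> T"
  then show "f i j + f (i + 1) j = f' i j + f' (i + 1) j"
    using interp_hedge_iff[of f i j "f i j + f (i + 1) j"] interp_hedge_iff[of f' i j "f i j + f (i + 1) j"]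
      assms(3) by (simp add: hedge_in_mesh_iff)
qed

lemma vinterp_inj:
  assumes "vanishes_outside a" "vanishes_outside b" "vanishes_outside a'" "vanishes_outside b'"
    and "vinterp a b = vinterp a' b'"
  shows "a = a' \<and> b = b'"
  using assms(5) interp_inj assms(1-4) unfolding vinterp_def by (metis ext prod.inject)

lemma vinterp_value_iff:
  "has_midpoint_value h T (vinterp a b) e c \<longleftrightarrow>
     has_midpoint_value h T (interp a) e (fst c) \<and> has_midpoint_value h T (interp b) e (snd c)"
  unfolding has_midpoint_value_def vinterp_def
  using tendsto_fst[of "\<lambda>z. (interp a z, interp b z)" c] tendsto_snd[of "\<lambda>z. (interp a z, interp b z)" c]
    tendsto_Pair[of "interp a" "fst c" _ "interp b" "snd c"] by auto

definition delta :: "int \<Rightarrow> int \<Rightarrow> int \<Rightarrow> int \<Rightarrow> real" where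
  "delta k l i j = of_bool (i = k \<and> j = l)"

text \<open>
  The interpolant of a point mass at the vertex satisfies the description of \<^const>\<open>psi\<close>; it is the only
  such field because fields in the nonconforming space come from vertex values, which are
  determined by the midpoint values.
\<close>
lemma psi_eq_vinterp:
  assumes "pt k l \<in> \<Omega>"
  shows "psi \<Omega> h T (pt k l) c = vinterp (\<lambda>i j. fst c * delta k l i j) (\<lambda>i j. snd c * delta k l i j)"
    (is "_ = vinterp ?a ?b")
proof -
  let ?val = "\<lambda>v. \<forall>(a, b)\<in>mesh_edges h T.
        has_midpoint_value h T v (a, b) (if pt k l = a \<or> pt k l = b then c else (0, 0))"
  have out: "vanishes_outside ?a" "vanishes_outside ?b"
    using assms by (auto simp: vanishes_outside_def delta_def)
  have "?val (vinterp ?a ?b)"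
  proof
    fix e assume "e \<in> mesh_edges h T"
    then show "case e of (a, b) \<Rightarrow>
        has_midpoint_value h T (vinterp ?a ?b) (a, b) (if pt k l = a \<or> pt k l = b then c else (0, 0))"
    proof (cases rule: mesh_edge_cases)
      case (1 i j)
      then show ?thesis
        using interp_hedge_iff[of ?a i j] interp_hedge_iff[of ?b i j]
        by (auto simp: vinterp_value_iff hedge_def delta_def)
    next
      case (2 i j)
      then show ?thesis
        using interp_vedge_iff[of ?a i j] interp_vedge_iff[of ?b i j]
        by (auto simp: vinterp_value_iff vedge_def delta_def)
    qed
  qed
  moreover have "v = vinterp ?a ?b" if "v \<in> NC0_vec \<Omega> h T" "?val v" for v
  proof -
    obtain a b where ab: "vanishes_outside a" "vanishes_outside b" "v = vinterp a b"
      using \<open>v \<in> NC0_vec \<Omega> h T\<close> NC0_vec_iff by blast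
    have *: "a i j + a (i + 1) j = ?a i j + ?a (i + 1) j \<and> b i j + b (i + 1) j = ?b i j + ?b (i + 1) j"
      if "pt i j \<in> T" for i j
    proof -
      have "hedge i j \<in> mesh_edges h T" using that by (simp add: hedge_in_mesh_iff)
      then have "has_midpoint_value h T (vinterp a b) (hedge i j)
          (if pt k l = pt i j \<or> pt k l = pt (i + 1) j then c else (0, 0))"
        using \<open>?val v\<close> ab(3) unfolding hedge_def by blast
      then show ?thesis
        using \<open>hedge i j \<in> mesh_edges h T\<close>
        by (auto simp: vinterp_value_iff interp_hedge_iff delta_def split: if_splits)
    qed
    have "a = ?a" "b = ?b"
      using vertex_values_unique[OF ab(1) out(1)] vertex_values_unique[OF ab(2) out(2)] * by blast+
    then show ?thesis using ab(3) by simp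
  qed
  moreover have "vinterp ?a ?b \<in> NC0_vec \<Omega> h T" using out NC0_vec_iff by blast
  ultimately show ?thesis unfolding psi_def by (intro the_equality) blast+
qed

text \<open>
  The rotated gradient at the vertex \<open>(i, j)\<close> of a function on the four cells around it.  The cell to
  the left and below this vertex has the index \<open>(i - 1, j - 1)\<close>.
\<close>
definition curl_x :: "(int \<Rightarrow> int \<Rightarrow> real) \<Rightarrow> int \<Rightarrow> int \<Rightarrow> real" where
  "curl_x g i j = (g (i - 1) (j - 1) + g i (j - 1) - g i j - g (i - 1) j) / 2"

definition curl_y :: "(int \<Rightarrow> int \<Rightarrow> real) \<Rightarrow> int \<Rightarrow> int \<Rightarrow> real" where
  "curl_y g i j = (- g (i - 1) (j - 1) + g i (j - 1) + g i j - g (i - 1) j) / 2"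

definition interior_squares :: "(int \<times> int) set" where
  "interior_squares = {(k, l). pt k l \<in> T \<and> interior_square \<Omega> h (pt k l)}"

lemma interior_squares_iff:
  "(k, l) \<in> interior_squares \<longleftrightarrow>
     pt k l \<in> \<Omega> \<and> pt (k + 1) l \<in> \<Omega> \<and> pt k (l + 1) \<in> \<Omega> \<and> pt (k + 1) (l + 1) \<in> \<Omega>"
proof (cases "pt k l \<in> T")
  case True
  have "a \<in> frontier \<Omega> \<longleftrightarrow> a \<notin> \<Omega>" if "a \<in> square h (pt k l)" for a
    using that True closure_domain open_domain by (auto simp: frontier_def interior_open)
  then show ?thesis
    using True by (auto simp: interior_squares_def interior_square_def boundary_vertex_def
        square_vertices_def pt_mem_square_iff)
next
  case False
  then show ?thesis by (auto simp: interior_squares_def vertex_in_domain_iff)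
qed

lemma finite_interior_squares: "finite interior_squares"
proof (rule finite_imageD)
  show "finite ((\<lambda>(k, l). pt k l) ` interior_squares)"
    by (rule finite_subset[OF _ finite_T]) (auto simp: interior_squares_def)
  show "inj_on (\<lambda>(k, l). pt k l) interior_squares" by (auto simp: inj_on_def)
qed

text \<open>
  Coefficient functions of linear combinations of the \<^const>\<open>Psi\<close>, indexed by all lattice cells.
\<close>
definition stream_function :: "(int \<Rightarrow> int \<Rightarrow> real) \<Rightarrow> bool" where
  "stream_function g \<longleftrightarrow> (\<forall>k l. (k, l) \<notin> interior_squares \<longrightarrow> g k l = 0)"

lemma curl_vanishes_outside:
  assumes "stream_function g"
  shows "vanishes_outside (curl_x g)" "vanishes_outside (curl_y g)"
  using assms
  by (auto simp: vanishes_outside_def curl_x_def curl_y_def stream_function_def interior_squares_iff)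

lemma Psi_eq_curl:
  assumes "(k, l) \<in> interior_squares"
  shows "Psi \<Omega> h T (pt k l) = vinterp (curl_x (delta k l)) (curl_y (delta k l))"
proof -
  have shift: "delta (k + 1) l i j = delta k l (i - 1) j" "delta k (l + 1) i j = delta k l i (j - 1)"
    "delta (k + 1) (l + 1) i j = delta k l (i - 1) (j - 1)" for i j
    by (auto simp: delta_def)
  have V: "pt k l \<in> \<Omega>" "pt (k + 1) l \<in> \<Omega>" "pt k (l + 1) \<in> \<Omega>" "pt (k + 1) (l + 1) \<in> \<Omega>"
    using assms by (auto simp: interior_squares_iff)
  show ?thesis
    unfolding Psi_def V_pt V[THEN psi_eq_vinterp] vinterp_add shift
    by (intro arg_cong2[where f = vinterp] ext) (simp_all add: curl_x_def curl_y_def field_simps)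
qed

text \<open>
  Each \<^const>\<open>Psi\<close> is the field of the curl of a point mass on a cell, and curl and
  interpolation are linear.
\<close>
lemma sum_Psi:
  assumes "stream_function g"
  shows "(\<Sum>(k, l)\<in>interior_squares. g k l *\<^sub>R Psi \<Omega> h T (pt k l)) = vinterp (curl_x g) (curl_y g)"
proof -
  have "(\<Sum>(k, l)\<in>S. g k l *\<^sub>R Psi \<Omega> h T (pt k l)) =
      vinterp (curl_x (\<lambda>i j. \<Sum>(k, l)\<in>S. g k l * delta k l i j)) (curl_y (\<lambda>i j. \<Sum>(k, l)\<in>S. g k l * delta k l i j))"
    if "finite S" "S \<subseteq> interior_squares" for S
    using that
  proof (induction S)
    case empty
    then show ?case by (simp add: curl_x_def[abs_def] curl_y_def[abs_def] vinterp_zero)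
  next
    case (insert q S)
    obtain k l where q: "q = (k, l)" by (cases q)
    let ?F = "\<lambda>S i j. \<Sum>(k, l)\<in>S. g k l * delta k l i j"
    have F: "?F (insert q S) = (\<lambda>i j. g k l * delta k l i j + ?F S i j)"
      using insert.hyps by (simp add: q)
    have "(\<Sum>(k, l)\<in>insert q S. g k l *\<^sub>R Psi \<Omega> h T (pt k l)) =
        g k l *\<^sub>R vinterp (curl_x (delta k l)) (curl_y (delta k l)) + vinterp (curl_x (?F S)) (curl_y (?F S))"
      using insert by (simp add: q Psi_eq_curl)
    also have "\<dots> = vinterp (curl_x (?F (insert q S))) (curl_y (?F (insert q S)))"
      unfolding F vinterp_scale vinterp_add
      by (intro arg_cong2[where f = vinterp] ext) (simp_all add: curl_x_def curl_y_def field_simps)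
    finally show ?case .
  qed
  moreover have "(\<Sum>(k, l)\<in>interior_squares. g k l * delta k l i j) = g i j" for i j
  proof -
    have "(\<Sum>(k, l)\<in>interior_squares. g k l * delta k l i j) =
        (\<Sum>q\<in>interior_squares. if q = (i, j) then g i j else 0)"
      by (rule sum.cong) (auto simp: delta_def)
    then show ?thesis using assms finite_interior_squares by (auto simp: stream_function_def)
  qed
  ultimately show ?thesis using finite_interior_squares by simp
qed

text \<open>
  The difference of the two components of the curl is the decrement of \<open>g\<close> across a vertex in the
  direction \<open>(1, 1)\<close>, so the difference of two stream functions with the same curl is constant on
  diagonals, and each of these leaves the mesh.
\<close>
lemma stream_function_unique:
  assumes "stream_function g" "stream_function g'"
    and "vinterp (curl_x g) (curl_y g) = vinterp (curl_x g') (curl_y g')"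
  shows "g = g'"
proof -
  have curls: "curl_x g = curl_x g'" "curl_y g = curl_y g'"
    using vinterp_inj curl_vanishes_outside assms by blast+
  obtain m where m: "\<And>i j. i < m \<Longrightarrow> pt i j \<notin> T" using mesh_bounded_left by metis
  have left: "g i j = g' i j" if "i < m" for i j
    using m[OF that] assms(1,2) by (simp add: stream_function_def interior_squares_def)
  have diag: "g (i + 1) j - g' (i + 1) j = g i (j - 1) - g' i (j - 1)" for i j
    using fun_cong[OF fun_cong[OF curls(1)], of "i + 1" j] fun_cong[OF fun_cong[OF curls(2)], of "i + 1" j]
    by (simp add: curl_x_def curl_y_def field_simps)
  have "\<forall>j. g i j = g' i j" if "m - 1 \<le> i" for i
    using that
  proof (induction i rule: int_ge_induct)
    case base
    then show ?case using left by simp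
  next
    case (step i)
    then show ?case using diag[of i] by simp
  qed
  then show ?thesis using left by (metis ext diff_add_cancel linorder_not_less order_less_le zle_diff1_eq)
qed

lemma divergence_vinterp:
  assumes "pt i j \<in> T" "z \<in> open_square h (pt i j)"
  shows "divergence (vinterp a b) z = (slope_x a i j + slope_y b i j) / h"
proof -
  let ?A = "\<lambda>z. (affine_piece a i j (X z) (Y z), affine_piece b i j (X z) (Y z))"
  let ?D = "\<lambda>w. (slope_x a i j * (fst w / h) + slope_y a i j * (snd w / h),
      slope_x b i j * (fst w / h) + slope_y b i j * (snd w / h))"
  have XY: "(X has_derivative (\<lambda>w. fst w / h)) (at z)" "(Y has_derivative (\<lambda>w. snd w / h)) (at z)"
    unfolding X_def Y_def using h_pos by (auto intro!: derivative_eq_intros simp: divide_inverse)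
  have "(?A has_derivative ?D) (at z)"
    unfolding affine_piece_def
    by (rule has_derivative_Pair; (rule derivative_eq_intros XY refl)+; auto)
  then have "(vinterp a b has_derivative ?D) (at z)"
    by (rule has_derivative_transform_within_open[OF _ open_open_square assms(2)])
      (simp add: vinterp_def interp_on_cell[OF assms(1)])
  then have "frechet_derivative (vinterp a b) (at z) = ?D"
    by (rule frechet_derivative_at[symmetric])
  then show ?thesis by (simp add: divergence_def add_divide_distrib)
qed

text \<open>
  On a cell outside the mesh all vertex values are zero, so the discrete divergence condition can be
  stated on the entire lattice.
\<close>
lemma V_space_iff:
  "v \<in> V_space \<Omega> h T \<longleftrightarrow> (\<exists>a b. vanishes_outside a \<and> vanishes_outside b \<and> v = vinterp a b \<and>
      (\<forall>i j. slope_x a i j + slope_y b i j = 0))"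
proof -
  have div_iff: "div_h h T (vinterp a b) = 0 \<longleftrightarrow> (\<forall>i j. slope_x a i j + slope_y b i j = 0)"
    if ab: "vanishes_outside a" "vanishes_outside b" for a b
  proof
    assume div: "div_h h T (vinterp a b) = 0"
    show "\<forall>i j. slope_x a i j + slope_y b i j = 0"
    proof (intro allI)
      fix i j
      show "slope_x a i j + slope_y b i j = 0"
      proof (cases "pt i j \<in> T")
        case True
        obtain z where z: "z \<in> open_square h (pt i j)" using open_square_nonempty by blast
        then have "div_h h T (vinterp a b) z = (slope_x a i j + slope_y b i j) / h"
          using True divergence_vinterp mesh_cells_iff unfolding div_h_def by auto
        then show ?thesis using div h_pos by simp
      next
        case False
        then have "pt i j \<notin> \<Omega>" "pt (i + 1) j \<notin> \<Omega>" "pt i (j + 1) \<notin> \<Omega>" "pt (i + 1) (j + 1) \<notin> \<Omega>"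
          by (auto simp: vertex_in_domain_iff)
        then show ?thesis using ab by (simp add: slope_x_def slope_y_def vanishes_outside_def)
      qed
    qed
  next
    assume *: "\<forall>i j. slope_x a i j + slope_y b i j = 0"
    have "div_h h T (vinterp a b) z = 0" for z
    proof (cases "z \<in> mesh_cells h T")
      case True
      then obtain i j where "pt i j \<in> T" "z \<in> open_square h (pt i j)" by (auto simp: mesh_cells_iff)
      then show ?thesis using divergence_vinterp[of i j z a b] * by (simp add: div_h_def)
    qed (simp add: div_h_def)
    then show "div_h h T (vinterp a b) = 0" by (simp add: fun_eq_iff)
  qed
  have "v \<in> V_space \<Omega> h T \<longleftrightarrow>
      (\<exists>a b. vanishes_outside a \<and> vanishes_outside b \<and> v = vinterp a b \<and> div_h h T (vinterp a b) = 0)"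
    unfolding V_space_def mem_Collect_eq NC0_vec_iff by metis
  then show ?thesis by (simp add: div_iff cong: conj_cong)
qed

lemma curl_divergence_free: "slope_x (curl_x g) i j + slope_y (curl_y g) i j = 0"
  by (simp add: slope_x_def slope_y_def curl_x_def curl_y_def field_simps)

text \<open>
  The increments of \<open>g\<close> across a vertex are \<open>-d\<close> towards the right and top, and \<open>s\<close> towards the right and bottom;
  zero divergence is the compatibility of the two around a cell.  At a vertex outside the
  domain \<open>s\<close> and \<open>d\<close> vanish, so opposite cells at this vertex have equal values of \<open>g\<close>.  For a cell
  outside the mesh this holds at all four vertices.  Its four edge neighbours then carry the same
  value, and the vanishing of \<open>g\<close> on all cells around one vertex passes to the other three.
\<close>
lemma divergence_free_imp_curl:
  assumes ab: "vanishes_outside a" "vanishes_outside b"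
    and div: "\<And>i j. slope_x a i j + slope_y b i j = 0"
  obtains g where "stream_function g" "a = curl_x g" "b = curl_y g"
proof -
  define s where "s i j = a i j + b i j" for i j
  define d where "d i j = a i j - b i j" for i j
  have out: "s i j = 0" "d i j = 0" if "pt i j \<notin> \<Omega>" for i j
    using ab that by (auto simp: s_def d_def vanishes_outside_def)
  obtain m where m: "\<And>i j. i < m \<Longrightarrow> pt i j \<notin> T" using mesh_bounded_left by metis
  have m_out: "pt i j \<notin> \<Omega>" if "i \<le> m" for i j
    using m[of "i - 1" j] that by (auto simp: vertex_in_domain_iff)
  have "- d (i + 1 + 1) (j + - 1 + 1) + 1 * s (i + 1) j =
      s (i + 1 + 1) (j + 1) + 1 * - d (i + 1) (j + 1)" for i j
    using div[of "i + 1" j] by (simp add: slope_x_def slope_y_def s_def d_def algebra_simps)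
  moreover have "- d (i + 1) (j + 1) = 0" "s (i + 1) j = 0" if "i < m" for i j
    using out m_out that by auto
  ultimately obtain g where g: "\<And>i j. g (i + 1) (j + 1) = - d (i + 1) (j + 1) + 1 * g i j"
    "\<And>i j. g (i + 1) (j + - 1) = s (i + 1) j + 1 * g i j"
    and left: "\<And>i j. i \<le> m \<Longrightarrow> g i j = 0"
    by (rule lattice_potential[of 1 "\<lambda>i j. - d (i + 1) (j + 1)" "- 1" 1 "\<lambda>i j. s (i + 1) j" 1 m,
        OF disjI2[OF refl]]) blast+
  have s_eq: "s i j = g i (j - 1) - g (i - 1) j" for i j using g(2)[of "i - 1" j] by simp
  have d_eq: "d i j = g (i - 1) (j - 1) - g i j" for i j using g(1)[of "i - 1" "j - 1"] by simp
  have "a i j = curl_x g i j" "b i j = curl_y g i j" for i j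
    using s_eq[of i j] d_eq[of i j] by (auto simp: s_def d_def curl_x_def curl_y_def field_simps)
  moreover have "stream_function g"
  proof -
    \<comment> \<open>Opposite cells at a vertex have the same chessboard colour, so the relations at vertices
      never compare the two colours; \<open>P\<close> asks for both.\<close>
    define P where "P i j \<longleftrightarrow> g i j = 0 \<and> g (i - 1) j = 0 \<and> g i (j - 1) = 0 \<and> g (i - 1) (j - 1) = 0" for i j
    have step: "P k' l'"
      if cell: "pt i j \<notin> T" "pt k l \<in> square h (pt i j)" "pt k' l' \<in> square h (pt i j)" and "P k l"
      for i j k l k' l'
    proof -
      have V: "pt i j \<notin> \<Omega>" "pt (i + 1) j \<notin> \<Omega>" "pt i (j + 1) \<notin> \<Omega>" "pt (i + 1) (j + 1) \<notin> \<Omega>"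
        using cell(1) by (auto simp: vertex_in_domain_iff)
      note eqs = out(1)[OF V(1)] out(2)[OF V(1)] out(1)[OF V(2)] out(2)[OF V(2)]
        out(1)[OF V(3)] out(2)[OF V(3)] out(1)[OF V(4)] out(2)[OF V(4)]
      show ?thesis using cell(2,3) \<open>P k l\<close> eqs unfolding pt_mem_square_iff P_def s_eq d_eq by auto
    qed
    have all: "P c d" if "pt c d \<notin> \<Omega>" for c d
    proof -
      have "P m 0" using left by (simp add: P_def)
      then show ?thesis using propagate_over_complement[of P m 0 c d] step m_out[of m 0] that by blast
    qed
    have "g k l = 0" if "(k, l) \<notin> interior_squares" for k l
      using that all[of k l] all[of "k + 1" l] all[of k "l + 1"] all[of "k + 1" "l + 1"]
      unfolding interior_squares_iff P_def by auto
    then show ?thesis by (auto simp: stream_function_def)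
  qed
  ultimately show ?thesis using that by blast
qed

lemma subspace_V_space: "subspace (V_space \<Omega> h T)"
  unfolding subspace_def
proof (intro conjI ballI allI)
  have "vanishes_outside (\<lambda>i j. 0)" by (simp add: vanishes_outside_def)
  then show "0 \<in> V_space \<Omega> h T"
    unfolding V_space_iff by (intro exI[of _ "\<lambda>i j. 0"]) (simp add: vinterp_zero slope_x_def slope_y_def)
next
  fix v w assume "v \<in> V_space \<Omega> h T" "w \<in> V_space \<Omega> h T"
  then obtain a b a' b' where "vanishes_outside a" "vanishes_outside b" "v = vinterp a b"
      "\<forall>i j. slope_x a i j + slope_y b i j = 0"
      "vanishes_outside a'" "vanishes_outside b'" "w = vinterp a' b'"
      "\<forall>i j. slope_x a' i j + slope_y b' i j = 0"
    unfolding V_space_iff by blast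
  moreover have "slope_x (\<lambda>i j. a i j + a' i j) i j + slope_y (\<lambda>i j. b i j + b' i j) i j =
      (slope_x a i j + slope_y b i j) + (slope_x a' i j + slope_y b' i j)" for i j
    by (simp add: slope_x_def slope_y_def)
  ultimately show "v + w \<in> V_space \<Omega> h T"
    unfolding V_space_iff
    by (intro exI[of _ "\<lambda>i j. a i j + a' i j"] exI[of _ "\<lambda>i j. b i j + b' i j"])
      (simp add: vinterp_add vanishes_outside_def)
next
  fix c v assume "v \<in> V_space \<Omega> h T"
  then obtain a b where "vanishes_outside a" "vanishes_outside b" "v = vinterp a b"
      "\<forall>i j. slope_x a i j + slope_y b i j = 0"
    unfolding V_space_iff by blast
  moreover have "slope_x (\<lambda>i j. c * a i j) i j + slope_y (\<lambda>i j. c * b i j) i j =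
      c * (slope_x a i j + slope_y b i j)" for i j
    by (simp add: slope_x_def slope_y_def algebra_simps)
  ultimately show "c *\<^sub>R v \<in> V_space \<Omega> h T"
    unfolding V_space_iff
    by (intro exI[of _ "\<lambda>i j. c * a i j"] exI[of _ "\<lambda>i j. c * b i j"])
      (simp add: vinterp_scale vanishes_outside_def)
qed

lemma stream_function_delta: "(k, l) \<in> interior_squares \<Longrightarrow> stream_function (delta k l)"
  by (auto simp: stream_function_def delta_def)

abbreviation Psi_at :: "int \<times> int \<Rightarrow> point \<Rightarrow> real \<times> real" where
  "Psi_at q \<equiv> Psi \<Omega> h T (pt (fst q) (snd q))"

lemma basis_eq: "{Psi \<Omega> h T p | p. p \<in> T \<and> interior_square \<Omega> h p} = Psi_at ` interior_squares"
proof (intro set_eqI iffI)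
  fix v assume "v \<in> {Psi \<Omega> h T p | p. p \<in> T \<and> interior_square \<Omega> h p}"
  then obtain p where p: "p \<in> T" "interior_square \<Omega> h p" "v = Psi \<Omega> h T p" by blast
  obtain k l where "p = pt k l" using T_cases p(1) by blast
  then show "v \<in> Psi_at ` interior_squares"
    using p by (intro image_eqI[of _ _ "(k, l)"]) (auto simp: interior_squares_def)
next
  fix v assume "v \<in> Psi_at ` interior_squares"
  then obtain k l where "(k, l) \<in> interior_squares" "v = Psi_at (k, l)" by auto
  then have "pt k l \<in> T \<and> interior_square \<Omega> h (pt k l) \<and> v = Psi \<Omega> h T (pt k l)"
    by (simp add: interior_squares_def)
  then show "v \<in> {Psi \<Omega> h T p | p. p \<in> T \<and> interior_square \<Omega> h p}" by blast
qed

lemma Psi_at_inj: "inj_on Psi_at interior_squares"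
proof (rule inj_onI)
  fix q r assume q: "q \<in> interior_squares" "r \<in> interior_squares" "Psi_at q = Psi_at r"
  then have "delta (fst q) (snd q) = delta (fst r) (snd r)"
    using stream_function_unique stream_function_delta Psi_eq_curl by (metis prod.collapse)
  then have "delta (fst q) (snd q) (fst q) (snd q) = delta (fst r) (snd r) (fst q) (snd q)" by simp
  then show "q = r" by (auto simp: delta_def prod_eq_iff)
qed

lemma independent_Psi: "independent (Psi_at ` interior_squares)"
proof (rule real_vector.independent_if_scalars_zero)
  show "finite (Psi_at ` interior_squares)" using finite_interior_squares by simp
  fix c v assume sum: "(\<Sum>x\<in>Psi_at ` interior_squares. c x *\<^sub>R x) = 0" and v: "v \<in> Psi_at ` interior_squares"
  define g where "g k l = (if (k, l) \<in> interior_squares then c (Psi_at (k, l)) else 0)" for k l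
  have g: "stream_function g" by (simp add: stream_function_def g_def)
  have "vinterp (curl_x g) (curl_y g) = (\<Sum>q\<in>interior_squares. c (Psi_at q) *\<^sub>R Psi_at q)"
    unfolding sum_Psi[OF g, symmetric] by (rule sum.cong) (auto simp: g_def)
  also have "\<dots> = 0" using sum by (simp add: sum.reindex[OF Psi_at_inj] o_def)
  also have "\<dots> = vinterp (curl_x (\<lambda>i j. 0)) (curl_y (\<lambda>i j. 0))"
    by (simp add: curl_x_def[abs_def] curl_y_def[abs_def] vinterp_zero)
  finally have "g = (\<lambda>i j. 0)"
    using stream_function_unique g by (simp add: stream_function_def)
  moreover obtain k l where "(k, l) \<in> interior_squares" "v = Psi_at (k, l)" using v by auto
  ultimately show "c v = 0" using g_def[of k l] by simp
qed

lemma span_Psi: "span (Psi_at ` interior_squares) = V_space \<Omega> h T"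
proof
  have "Psi_at q \<in> V_space \<Omega> h T" if "q \<in> interior_squares" for q
  proof -
    obtain k l where q: "q = (k, l)" by (cases q)
    then have "stream_function (delta k l)" using that stream_function_delta by simp
    then show ?thesis
      unfolding V_space_iff using q that
      by (intro exI[of _ "curl_x (delta k l)"] exI[of _ "curl_y (delta k l)"])
        (simp add: Psi_eq_curl curl_vanishes_outside curl_divergence_free)
  qed
  then show "span (Psi_at ` interior_squares) \<subseteq> V_space \<Omega> h T"
    by (intro span_minimal subspace_V_space) blast
next
  show "V_space \<Omega> h T \<subseteq> span (Psi_at ` interior_squares)"
  proof
    fix v assume "v \<in> V_space \<Omega> h T"
    then obtain a b where ab: "vanishes_outside a" "vanishes_outside b" "v = vinterp a b"
      "\<And>i j. slope_x a i j + slope_y b i j = 0" unfolding V_space_iff by blast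
    obtain g where g: "stream_function g" "a = curl_x g" "b = curl_y g"
      using divergence_free_imp_curl[OF ab(1,2,4)] by blast
    have "v = (\<Sum>(k, l)\<in>interior_squares. g k l *\<^sub>R Psi_at (k, l))"
      using sum_Psi[OF g(1)] ab(3) g by simp
    also have "\<dots> \<in> span (Psi_at ` interior_squares)"
      by (intro span_sum) (force intro!: span_scale[OF span_base])
    finally show "v \<in> span (Psi_at ` interior_squares)" .
  qed
qed

end

theorem theorem3p5:
  fixes \<Omega> :: "point set" and h :: real and T :: "point set"
  assumes "polygonal_domain \<Omega>" and "simply_connected \<Omega>"
    and "square_triangulation \<Omega> h T"
    and "mesh_assumption \<Omega> h T"
  shows "independent {Psi \<Omega> h T p | p. p \<in> T \<and> interior_square \<Omega> h p} \<and>
    span {Psi \<Omega> h T p | p. p \<in> T \<and> interior_square \<Omega> h p} = V_space \<Omega> h T"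
proof -
  obtain org where "square_mesh \<Omega> h T org"
    using square_mesh_of_triangulation assms(1-3) by blast
  then interpret square_mesh \<Omega> h T org .
  show ?thesis
    unfolding basis_eq using independent_Psi span_Psi by blast
qed

end
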